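(* Let $\gamma:\mathbb{R}\to[0,\infty)$ be a continuous function with compact support. For each $n\ge1$, let the initial configuration $\Psi$ of quantum random walks be chosen according to the measure $\Theta^n_\gamma$, let $\eta^\Psi_m(k)$ denote the number of independent quantum random walks (driven by the Hadamard coin, started from the configuration $\Psi$) observed at site $k\in\mathbb{Z}$ at time $m\in\mathbb{N}$, and for $t>0$ let $\mu^\Psi_{\lfloor tn\rfloor}$ be the probability measure on $\mathbb{N}^{\mathbb{Z}}$ induced by the random element $\eta^\Psi_{\lfloor tn\rfloor}$. Then, for every $x\in\mathbb{R}$ and every $t>0$, $$\lim_{n\to\infty}\tau_{\lfloor xn\rfloor}\,\mu^\Psi_{\lfloor tn\rfloor}=\nu_{\rho(t,x)}$$ in the sense of weak convergence of probability measures on $\mathbb{N}^{\mathbb{Z}}$, where $$\rho(t,x)=\int_{\mathbb{R}}\gamma(y)\,\frac1t f\Big(\frac{x-y}{t}\Big)\,dy$$ and $f:\mathbb{R}\to[0,\infty)$ is the probability density $$f(x)=\begin{cases}\dfrac{1}{\pi(1-x^2)\sqrt{1-2x^2}}, & x\in\big(-\tfrac{\sqrt2}{2},\tfrac{\sqrt2}{2}\big),\\[2mm] 0,&\text{otherwise.}\end{cases}$$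
   Context: $\mathbb{N}=\{0,1,2,\dots\}$, and $\lfloor y\rfloor$ is the greatest integer less than or equal to $y$. State space. Let $\ell^2(\mathbb{Z})$ be the complex Hilbert space of square-summable doubly infinite sequences, with canonical orthonormal basis $\{e_k\}_{k\in\mathbb{Z}}$, and let $\{|{-1}\rangle,|{+1}\rangle\}$ be the canonical orthonormal basis of $\mathbb{C}^2$. The state space is the Hilbert space tensor product $\ell^2(\mathbb{Z})\otimes\mathbb{C}^2$. Dynamics. The Hadamard operator $H$ on $\mathbb{C}^2$ is the linear map with $H|{+1}\rangle=\frac{1}{\sqrt2}(|{+1}\rangle+|{-1}\rangle)$ and $H|{-1}\rangle=\frac{1}{\sqrt2}(|{+1}\rangle-|{-1}\rangle)$. The shift $S$ on $\ell^2(\mathbb{Z})\otimes\mathbb{C}^2$ is the bounded linear operator with $S(e_k\otimes|{+1}\rangle)=e_{k+1}\otimes|{+1}\rangle$ and $S(e_k\otimes|{-1}\rangle)=e_{k-1}\otimes|{-1}\rangle$ for all $k\in\mathbb{Z}$. Put $U=S\circ(\mathrm{Id}\otimes H)$, with $\mathrm{Id}$ the identity on $\ell^2(\mathbb{Z})$, and let $U^{(n)}$ be its $n$-fold iterate. Observed position. For a unit vector $\psi\in\ell^2(\mathbb{Z})\otimes\mathbb{C}^2$, write $U^{(n)}(\psi)=\big(\sum_k x^n_ke_k\big)\otimes|{+1}\rangle+\big(\sum_k y^n_ke_k\big)\otimes|{-1}\rangle$. Then $X^\psi_n$ denotes an integer-valued random variable with $\mathbb{P}(X^\psi_n=k)=|x^n_k|^2+|y^n_k|^2$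 for $k\in\mathbb{Z}$ (the position observed at time $n$ of a quantum random walk started from $\psi$). Systems of independent walks. A configuration of quantum random walks is a function $\Psi:\ell^2(\mathbb{Z})\otimes\mathbb{C}^2\to\mathbb{N}$, where $\Psi(\psi)$ is the number of walks in state $\psi$; only configurations with $\Psi(\psi)=0$ for all but finitely many $\psi$ are considered. Given $\Psi$, for each state $\psi$ let $X^\psi_n(1),\dots,X^\psi_n(\Psi(\psi))$ be copies of $X^\psi_n$, all of these (over all $\psi$ and all indices) being independent, and define $$\eta^\Psi_n(k)=\sum_{\psi}\sum_{j=1}^{\Psi(\psi)}\mathbf{1}[X^\psi_n(j)=k],\qquad k\in\mathbb{Z}.$$ Initial measure. $\Theta^n_\gamma$ is the product measure on $\mathbb{N}^{\ell^2(\mathbb{Z})\otimes\mathbb{C}^2}$ (that is, the numbers $\Psi(\psi)$ are independent over $\psi$) under which $\Psi(\psi)$ has distribution Poisson$\big(\frac12\gamma(\frac kn)\big)$ if $\psi=e_k\otimes|{+1}\rangle$ or $\psi=e_k\otimes|{-1}\rangle$ with $k\in\mathbb{Z}$, and $\Psi(\psi)=0$ almost surely for every other $\psi$. Here Poisson$(0)$ is the point mass at $0$. The measure $\mu^\Psi_{\lfloor tn\rfloor}$ is the law of $\eta^\Psi_{\lfloor tn\rfloor}$ under the joint randomness of $\Psi$ (chosen from $\Theta^n_\gamma$) and of the observed positions. Topology, translations, Poisson measures. $\mathbb{N}^{\mathbb{Z}}$ carries the metric $d(\eta_1,\eta_2)=\sum_{k\in\mathbb{Z}}2^{-|k|}\frac{|\eta_1(k)-\eta_2(k)|}{1+|\eta_1(k)-\eta_2(k)|}$.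 For $k\in\mathbb{Z}$ and $\eta\in\mathbb{N}^{\mathbb{Z}}$, $(\tau_k\eta)(j)=\eta(j+k)$; for a probability measure $\mu$ on $\mathbb{N}^{\mathbb{Z}}$, $\tau_k\mu$ is the unique probability measure with $\int g(\eta)\,(\tau_k\mu)(d\eta)=\int g(\tau_k\eta)\,\mu(d\eta)$ for all integrable continuous $g$. For $\alpha\ge0$, $\nu_\alpha$ is the product probability measure on $\mathbb{N}^{\mathbb{Z}}$ all of whose marginals are Poisson of parameter $\alpha$: $\nu_\alpha\{\eta:\eta(k)=\ell\}=e^{-\alpha}\alpha^\ell/\ell!$ for $k\in\mathbb{Z}$, $\ell\in\mathbb{N}$ (with $\nu_0$ the point mass at the zero configuration). *)

theory Defs
  imports "HOL-Probability.Probability"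
begin

section \<open>Spaces of square-summable families\<close>

typedef 'a ell2 = "{x :: 'a \<Rightarrow> complex. (\<lambda>i. (cmod (x i))\<^sup>2) summable_on UNIV}"
  morphisms coord Abs_ell2
  by (rule exI [of _ "\<lambda>_. 0"]) simp

setup_lifting type_definition_ell2

lemma ell2_eqI: "(\<And>i. coord x i = coord y i) \<Longrightarrow> x = y"
  by transfer auto

lemma coord_summable: "(\<lambda>i. (cmod (coord x i))\<^sup>2) summable_on UNIV"
  using coord [of x] by simp

lemma cmod_add_sq_le: "(cmod (a + b))\<^sup>2 \<le> 2 * (cmod a)\<^sup>2 + 2 * (cmod b)\<^sup>2"
proof -
  have "(cmod (a + b))\<^sup>2 \<le> (cmod a + cmod b)\<^sup>2"
    by (simp add: norm_triangle_ineq power_mono)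
  also have "\<dots> \<le> 2 * (cmod a)\<^sup>2 + 2 * (cmod b)\<^sup>2"
    using sum_squares_bound [of "cmod a" "cmod b"] by (simp add: power2_sum)
  finally show ?thesis .
qed

lemma sq_summable_add:
  assumes "(\<lambda>i. (cmod (x i))\<^sup>2) summable_on A" "(\<lambda>i. (cmod (y i))\<^sup>2) summable_on A"
  shows "(\<lambda>i. (cmod (x i + y i))\<^sup>2) summable_on A"
  by (rule summable_on_comparison_test
        [of "\<lambda>i. 2 * (cmod (x i))\<^sup>2 + 2 * (cmod (y i))\<^sup>2"])
    (auto intro!: summable_on_add summable_on_cmult_right assms cmod_add_sq_le)

lemma sq_summable_scale:
  assumes "(\<lambda>i. (cmod (x i))\<^sup>2) summable_on A"
  shows "(\<lambda>i. (cmod (c * x i))\<^sup>2) summable_on A"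
  using summable_on_cmult_right [OF assms, of "(cmod c)\<^sup>2"]
  by (simp add: norm_mult power_mult_distrib)

instantiation ell2 :: (type) real_vector
begin
lift_definition zero_ell2 :: "'a ell2" is "\<lambda>_. 0" by simp
lift_definition plus_ell2 :: "'a ell2 \<Rightarrow> 'a ell2 \<Rightarrow> 'a ell2" is "\<lambda>x y i. x i + y i"
  by (rule sq_summable_add)
lift_definition uminus_ell2 :: "'a ell2 \<Rightarrow> 'a ell2" is "\<lambda>x i. - x i" by simp
definition minus_ell2 :: "'a ell2 \<Rightarrow> 'a ell2 \<Rightarrow> 'a ell2" where "minus_ell2 x y = x + - y"
lift_definition scaleR_ell2 :: "real \<Rightarrow> 'a ell2 \<Rightarrow> 'a ell2" is "\<lambda>r x i. of_real r * x i"
  by (rule sq_summable_scale)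
instance
  by intro_classes (unfold minus_ell2_def, (transfer; auto simp: fun_eq_iff algebra_simps)+)
end

lift_definition scaleC :: "complex \<Rightarrow> 'a ell2 \<Rightarrow> 'a ell2" is "\<lambda>c x i. c * x i"
  by (rule sq_summable_scale)

definition cinner :: "'a ell2 \<Rightarrow> 'a ell2 \<Rightarrow> complex" where
  "cinner x y = (\<Sum>\<^sub>\<infinity>i. cnj (coord x i) * coord y i)"

lemma cinner_summable: "(\<lambda>i. cnj (coord x i) * coord y i) summable_on UNIV"
  by (rule abs_summable_summable, rule abs_summable_product)
    (use coord_summable [of x] coord_summable [of y] in
      \<open>simp_all add: norm_mult power2_eq_square\<close>)

lemmas coord_simps [simp] = zero_ell2.rep_eq plus_ell2.rep_eq uminus_ell2.rep_eq
  scaleR_ell2.rep_eq scaleC.rep_eq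

lemma cinner_self: "cinner x x = of_real (\<Sum>\<^sub>\<infinity>i. (cmod (coord x i))\<^sup>2)"
proof -
  have "cinner x x = (\<Sum>\<^sub>\<infinity>i. of_real ((cmod (coord x i))\<^sup>2))"
    unfolding cinner_def complex_norm_square by (simp add: mult.commute)
  also have "\<dots> = of_real (\<Sum>\<^sub>\<infinity>i. (cmod (coord x i))\<^sup>2)"
    by (intro infsumI has_sum_of_real has_sum_infsum coord_summable)
  finally show ?thesis .
qed

instantiation ell2 :: (type) real_inner
begin
definition inner_ell2 :: "'a ell2 \<Rightarrow> 'a ell2 \<Rightarrow> real" where
  "inner_ell2 x y = Re (cinner x y)"
definition norm_ell2 :: "'a ell2 \<Rightarrow> real" where
  "norm_ell2 x = sqrt (inner x x)"
definition sgn_ell2 :: "'a ell2 \<Rightarrow> 'a ell2" where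
  "sgn_ell2 x = x /\<^sub>R norm x"
definition dist_ell2 :: "'a ell2 \<Rightarrow> 'a ell2 \<Rightarrow> real" where
  "dist_ell2 x y = norm (x - y)"
definition uniformity_ell2 :: "('a ell2 \<times> 'a ell2) filter" where
  "uniformity_ell2 = (INF e\<in>{0<..}. principal {(x, y). dist x y < e})"
definition open_ell2 :: "'a ell2 set \<Rightarrow> bool" where
  "open_ell2 U \<longleftrightarrow> (\<forall>x\<in>U. \<forall>\<^sub>F (x', y) in uniformity. x' = x \<longrightarrow> y \<in> U)"
instance
proof
  fix x y z :: "'a ell2" and r :: real
  have "cinner x y = cnj (cinner y x)"
    unfolding cinner_def infsum_cnj [symmetric] by (simp add: mult.commute)
  then show "inner x y = inner y x"
    by (simp add: inner_ell2_def)
  have "cinner (x + y) z = cinner x z + cinner y z"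
    unfolding cinner_def infsum_add [OF cinner_summable cinner_summable, symmetric]
    by (simp add: algebra_simps)
  then show "inner (x + y) z = inner x z + inner y z"
    by (simp add: inner_ell2_def)
  have "cinner (r *\<^sub>R x) y = of_real r * cinner x y"
    unfolding cinner_def infsum_cmult_right' [symmetric] by (simp add: mult.assoc)
  then show "inner (r *\<^sub>R x) y = r * inner x y"
    by (simp add: inner_ell2_def)
  have nn: "inner x x = (\<Sum>\<^sub>\<infinity>i. (cmod (coord x i))\<^sup>2)"
    by (simp add: inner_ell2_def cinner_self)
  show "0 \<le> inner x x"
    unfolding nn by (rule infsum_nonneg) simp
  show "inner x x = 0 \<longleftrightarrow> x = 0"
  proof
    assume "inner x x = 0"
    then have "(cmod (coord x i))\<^sup>2 = 0" for i
      using nonneg_infsum_le_0D [of "\<lambda>i. (cmod (coord x i))\<^sup>2" UNIV i] coord_summable [of x]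
      unfolding nn by simp
    then show "x = 0"
      by (intro ell2_eqI) simp
  next
    assume "x = 0"
    then show "inner x x = 0" unfolding nn by simp
  qed
qed (simp_all only: norm_ell2_def sgn_ell2_def dist_ell2_def uniformity_ell2_def open_ell2_def)
end

lemma norm_ell2_sq: "(norm x)\<^sup>2 = (\<Sum>\<^sub>\<infinity>i. (cmod (coord x i))\<^sup>2)"
  unfolding power2_norm_eq_inner inner_ell2_def cinner_self by simp

lift_definition ket :: "'a \<Rightarrow> 'a ell2" is "\<lambda>a i. if i = a then 1 else 0"
  by (rule finite_nonzero_values_imp_summable_on) simp

text \<open>The Hilbert space tensor product of the square-summable families over two index sets is
  the space of square-summable families over the product of the index sets.\<close>

lift_definition tensor :: "'a ell2 \<Rightarrow> 'b ell2 \<Rightarrow> ('a \<times> 'b) ell2" (infixr \<open>\<otimes>\<^sub>h\<close> 70)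
  is "\<lambda>x y (i, j). x i * y j"
proof -
  fix x :: "'a \<Rightarrow> complex" and y :: "'b \<Rightarrow> complex"
  assume x: "(\<lambda>i. (cmod (x i))\<^sup>2) summable_on UNIV" and y: "(\<lambda>i. (cmod (y i))\<^sup>2) summable_on UNIV"
  have "(\<lambda>(i, j). (cmod (x i))\<^sup>2 * (cmod (y j))\<^sup>2) summable_on (UNIV \<times> UNIV)"
    by (rule summable_on_SigmaI [where g = "\<lambda>i. (cmod (x i))\<^sup>2 * (\<Sum>\<^sub>\<infinity>j. (cmod (y j))\<^sup>2)"])
      (auto intro!: has_sum_cmult_right has_sum_infsum summable_on_cmult_left x y)
  then show "(\<lambda>i. (cmod (case i of (i, j) \<Rightarrow> x i * y j))\<^sup>2) summable_on UNIV"
    by (simp add: case_prod_unfold norm_mult power_mult_distrib)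
qed

lemma coord_ket: "coord (ket a) i = (if i = a then 1 else 0)"
  by (simp add: ket.rep_eq)

lemma coord_tensor: "coord (x \<otimes>\<^sub>h y) (i, j) = coord x i * coord y j"
  by (simp add: tensor.rep_eq)

lemma tensor_ket: "ket i \<otimes>\<^sub>h ket j = ket (i, j)"
  by (rule ell2_eqI) (auto simp: coord_ket tensor.rep_eq split: if_splits)

lemma ket_eq_iff: "ket a = ket b \<longleftrightarrow> a = b"
  by (metis coord_ket zero_neq_one)

lemma norm_ket: "norm (ket a) = 1"
proof -
  have "(\<Sum>\<^sub>\<infinity>i. (cmod (coord (ket a) i))\<^sup>2) = (\<Sum>\<^sub>\<infinity>i\<in>{a}. 1)"
    by (rule infsum_cong_neutral) (auto simp: coord_ket)
  then have "(norm (ket a))\<^sup>2 = 1"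
    by (simp add: norm_ell2_sq)
  then show ?thesis
    using norm_ge_zero [of "ket a"] by (simp only: power2_eq_1_iff) linarith
qed


section \<open>The Hadamard walk\<close>

datatype coin = Minus | Plus

lemma UNIV_coin: "UNIV = {Minus, Plus}"
  by (rule UNIV_eq_I) (metis coin.exhaust insert_iff)

instance coin :: finite
  by standard (simp add: UNIV_coin)

lemma sum_coin: "(\<Sum>s\<in>UNIV. g s) = g Minus + g Plus"
  by (simp add: UNIV_coin)

type_synonym state = "(int \<times> coin) ell2"

text \<open>\<open>hadamard_entry s r\<close> is the coefficient of the basis vector \<open>s\<close> in the image of the
  basis vector \<open>r\<close>.\<close>

definition hadamard_entry :: "coin \<Rightarrow> coin \<Rightarrow> complex" where
  "hadamard_entry s r = (if s = Minus \<and> r = Minus then - 1 else 1) / of_real (sqrt 2)"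

lift_definition hadamard :: "coin ell2 \<Rightarrow> coin ell2"
  is "\<lambda>v s. \<Sum>r\<in>UNIV. hadamard_entry s r * v r"
  by simp

lemma summable_on_section:
  fixes f :: "int \<times> coin \<Rightarrow> real"
  assumes "f summable_on UNIV"
  shows "(\<lambda>k. f (k, s)) summable_on UNIV"
proof -
  have "f summable_on range (\<lambda>k. (k, s))"
    using assms by (rule summable_on_subset_banach) simp
  then have "(f \<circ> (\<lambda>k. (k, s))) summable_on UNIV"
    by (subst (asm) summable_on_reindex) (simp_all add: inj_on_def)
  then show ?thesis by (simp only: o_def)
qed

lemma summable_on_sections:
  fixes f :: "int \<times> coin \<Rightarrow> real"
  assumes "\<And>s. (\<lambda>k. f (k, s)) summable_on UNIV"
  shows "f summable_on UNIV"
proof -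
  have "f summable_on range (\<lambda>k. (k, s))" for s
    by (subst summable_on_reindex) (simp_all add: inj_on_def o_def assms)
  then have "f summable_on (range (\<lambda>k. (k, Minus)) \<union> range (\<lambda>k. (k, Plus)))"
    by (intro summable_on_union)
  moreover have "range (\<lambda>k. (k, Minus)) \<union> range (\<lambda>k. (k, Plus)) = (UNIV :: (int \<times> coin) set)"
    by (simp add: set_eq_iff image_iff) (metis coin.exhaust)
  ultimately show ?thesis by simp
qed

lift_definition id_tensor_hadamard :: "state \<Rightarrow> state"
  is "\<lambda>\<psi> (k, s). \<Sum>r\<in>UNIV. hadamard_entry s r * \<psi> (k, r)"
proof (rule summable_on_sections)
  fix \<psi> :: "int \<times> coin \<Rightarrow> complex" and s
  assume *: "(\<lambda>i. (cmod (\<psi> i))\<^sup>2) summable_on UNIV"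
  have "(\<lambda>k. (cmod (\<Sum>r\<in>UNIV. hadamard_entry s r * \<psi> (k, r)))\<^sup>2) summable_on UNIV"
    unfolding sum_coin by (intro sq_summable_add sq_summable_scale summable_on_section [OF *])
  then show "(\<lambda>k. (cmod (case (k, s) of (k, s) \<Rightarrow>
      \<Sum>r\<in>UNIV. hadamard_entry s r * \<psi> (k, r)))\<^sup>2) summable_on UNIV"
    by simp
qed

text \<open>\<open>unshift\<close> is the inverse of the permutation of basis labels that the shift induces.\<close>

definition unshift :: "int \<times> coin \<Rightarrow> int \<times> coin" where
  "unshift = (\<lambda>(k, s). (case s of Plus \<Rightarrow> k - 1 | Minus \<Rightarrow> k + 1, s))"

lemma bij_unshift: "bij unshift"
  by (rule o_bij [where g = "\<lambda>(k, s). (case s of Plus \<Rightarrow> k + 1 | Minus \<Rightarrow> k - 1, s)"])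
    (auto simp: unshift_def fun_eq_iff split: coin.splits)

lift_definition coin_shift :: "state \<Rightarrow> state" is "\<lambda>\<psi> i. \<psi> (unshift i)"
  by (subst summable_on_reindex_bij_betw [OF bij_unshift])

definition walk_step :: "state \<Rightarrow> state" where
  "walk_step = coin_shift \<circ> id_tensor_hadamard"

lemma coord_minus: "coord (x - y) i = coord x i - coord y i"
  by (simp only: minus_ell2_def plus_ell2.rep_eq uminus_ell2.rep_eq) simp

lemma hadamard_ket:
  "hadamard (ket Plus) = (1 / sqrt 2) *\<^sub>R (ket Plus + ket Minus)"
  "hadamard (ket Minus) = (1 / sqrt 2) *\<^sub>R (ket Plus - ket Minus)"
proof -
  have "coord (hadamard (ket Plus)) s = coord ((1 / sqrt 2) *\<^sub>R (ket Plus + ket Minus)) s"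
    "coord (hadamard (ket Minus)) s = coord ((1 / sqrt 2) *\<^sub>R (ket Plus - ket Minus)) s" for s
    by (cases s; simp add: hadamard.rep_eq coord_ket coord_minus sum_coin hadamard_entry_def)+
  then show "hadamard (ket Plus) = (1 / sqrt 2) *\<^sub>R (ket Plus + ket Minus)"
    "hadamard (ket Minus) = (1 / sqrt 2) *\<^sub>R (ket Plus - ket Minus)"
    by (blast intro: ell2_eqI)+
qed

lemma id_tensor_hadamard_tensor: "id_tensor_hadamard (x \<otimes>\<^sub>h v) = x \<otimes>\<^sub>h hadamard v"
proof (rule ell2_eqI)
  fix p :: "int \<times> coin"
  obtain k s where p: "p = (k, s)" by (cases p)
  show "coord (id_tensor_hadamard (x \<otimes>\<^sub>h v)) p = coord (x \<otimes>\<^sub>h hadamard v) p"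
    unfolding p by (simp add: id_tensor_hadamard.rep_eq coord_tensor hadamard.rep_eq sum_coin
        algebra_simps)
qed

lemma unshift_eq_iff:
  "unshift p = (k, Plus) \<longleftrightarrow> p = (k + 1, Plus)"
  "unshift p = (k, Minus) \<longleftrightarrow> p = (k - 1, Minus)"
  by (cases p; cases "snd p"; auto simp: unshift_def)+

lemma coin_shift_ket:
  "coin_shift (ket k \<otimes>\<^sub>h ket Plus) = ket (k + 1) \<otimes>\<^sub>h ket Plus"
  "coin_shift (ket k \<otimes>\<^sub>h ket Minus) = ket (k - 1) \<otimes>\<^sub>h ket Minus"
  unfolding tensor_ket
  by (rule ell2_eqI, simp only: coin_shift.rep_eq coord_ket unshift_eq_iff)+

lemma norm_coin_shift: "norm (coin_shift \<psi>) = norm \<psi>"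
proof -
  have "(norm (coin_shift \<psi>))\<^sup>2 = (norm \<psi>)\<^sup>2"
    unfolding norm_ell2_sq coin_shift.rep_eq
    using infsum_reindex_bij_betw [OF bij_unshift, of "\<lambda>i. (cmod (coord \<psi> i))\<^sup>2"] by simp
  then show ?thesis by simp
qed

lemma norm_state_sq:
  "((\<lambda>k. (cmod (coord \<psi> (k, Plus)))\<^sup>2 + (cmod (coord \<psi> (k, Minus)))\<^sup>2) has_sum (norm \<psi>)\<^sup>2) UNIV"
  for \<psi> :: state
proof -
  have h: "((\<lambda>i. (cmod (coord \<psi> i))\<^sup>2) has_sum (norm \<psi>)\<^sup>2) (UNIV \<times> UNIV)"
    unfolding norm_ell2_sq by (simp add: coord_summable)
  have "((\<lambda>k. \<Sum>s\<in>UNIV. (cmod (coord \<psi> (k, s)))\<^sup>2) has_sum (norm \<psi>)\<^sup>2) UNIV"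
    by (rule has_sum_Sigma' [OF h]) (simp add: has_sum_finite)
  then show ?thesis
    by (simp add: sum_coin add.commute)
qed

lemma norm_id_tensor_hadamard: "norm (id_tensor_hadamard \<psi>) = norm \<psi>"
proof -
  have par: "(cmod (a / of_real (sqrt 2) + b / of_real (sqrt 2)))\<^sup>2 +
      (cmod (a / of_real (sqrt 2) - b / of_real (sqrt 2)))\<^sup>2 = (cmod a)\<^sup>2 + (cmod b)\<^sup>2"
    for a b :: complex
  proof -
    have "(cmod (a / of_real (sqrt 2) + b / of_real (sqrt 2)))\<^sup>2 = (cmod (a + b))\<^sup>2 / 2"
      "(cmod (a / of_real (sqrt 2) - b / of_real (sqrt 2)))\<^sup>2 = (cmod (a - b))\<^sup>2 / 2"
      by (simp_all only: add_divide_distrib [symmetric] diff_divide_distrib [symmetric] norm_divide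
          power_divide) simp_all
    then have "(cmod (a / of_real (sqrt 2) + b / of_real (sqrt 2)))\<^sup>2 +
        (cmod (a / of_real (sqrt 2) - b / of_real (sqrt 2)))\<^sup>2 =
        (cmod (a + b))\<^sup>2 / 2 + (cmod (a - b))\<^sup>2 / 2"
      by (simp only:)
    also have "\<dots> = (cmod a)\<^sup>2 + (cmod b)\<^sup>2"
      by (simp add: cmod_power2 power2_sum power2_diff field_simps)
    finally show ?thesis .
  qed
  have "(cmod (coord (id_tensor_hadamard \<psi>) (k, Plus)))\<^sup>2 +
      (cmod (coord (id_tensor_hadamard \<psi>) (k, Minus)))\<^sup>2 =
      (cmod (coord \<psi> (k, Plus)))\<^sup>2 + (cmod (coord \<psi> (k, Minus)))\<^sup>2" for k
    using par [of "coord \<psi> (k, Plus)" "coord \<psi> (k, Minus)"]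
    by (simp add: id_tensor_hadamard.rep_eq sum_coin hadamard_entry_def add.commute)
  then have "((\<lambda>k. (cmod (coord \<psi> (k, Plus)))\<^sup>2 + (cmod (coord \<psi> (k, Minus)))\<^sup>2)
      has_sum (norm (id_tensor_hadamard \<psi>))\<^sup>2) UNIV"
    using norm_state_sq [of "id_tensor_hadamard \<psi>"] by (simp only:)
  then have "(norm (id_tensor_hadamard \<psi>))\<^sup>2 = (norm \<psi>)\<^sup>2"
    using norm_state_sq [of \<psi>] by (rule has_sum_unique)
  then show ?thesis by simp
qed

lemma bounded_linear_coin_shift: "bounded_linear coin_shift"
proof (rule bounded_linear_intro [where K = 1])
  show "coin_shift (x + y) = coin_shift x + coin_shift y" for x y
    by (rule ell2_eqI) (simp add: coin_shift.rep_eq)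
  show "coin_shift (r *\<^sub>R x) = r *\<^sub>R coin_shift x" for r x
    by (rule ell2_eqI) (simp add: coin_shift.rep_eq)
qed (simp add: norm_coin_shift)

lemma coin_shift_scaleC: "coin_shift (scaleC c \<psi>) = scaleC c (coin_shift \<psi>)"
  by (rule ell2_eqI) (simp add: coin_shift.rep_eq)

lemma bounded_linear_id_tensor_hadamard: "bounded_linear id_tensor_hadamard"
proof (rule bounded_linear_intro [where K = 1])
  show "id_tensor_hadamard (x + y) = id_tensor_hadamard x + id_tensor_hadamard y" for x y
    by (rule ell2_eqI) (simp add: id_tensor_hadamard.rep_eq sum_coin case_prod_unfold algebra_simps)
  show "id_tensor_hadamard (r *\<^sub>R x) = r *\<^sub>R id_tensor_hadamard x" for r x
    by (rule ell2_eqI) (simp add: id_tensor_hadamard.rep_eq sum_coin case_prod_unfold algebra_simps)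
qed (simp add: norm_id_tensor_hadamard)

lemma id_tensor_hadamard_scaleC:
  "id_tensor_hadamard (scaleC c \<psi>) = scaleC c (id_tensor_hadamard \<psi>)"
  by (rule ell2_eqI) (simp add: id_tensor_hadamard.rep_eq sum_coin case_prod_unfold algebra_simps)

lemma norm_walk: "norm ((walk_step ^^ n) \<psi>) = norm \<psi>"
  by (induction n) (simp_all add: walk_step_def norm_coin_shift norm_id_tensor_hadamard)

text \<open>Only used for unit vectors \<open>\<psi>\<close>, for which the weights add up to one.\<close>

definition position_pmf :: "nat \<Rightarrow> state \<Rightarrow> int pmf" where
  "position_pmf n \<psi> = embed_pmf (\<lambda>k.
     (cmod (coord ((walk_step ^^ n) \<psi>) (k, Plus)))\<^sup>2 +
     (cmod (coord ((walk_step ^^ n) \<psi>) (k, Minus)))\<^sup>2)"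

lemma pmf_position:
  assumes "norm \<psi> = 1"
  shows "pmf (position_pmf n \<psi>) k =
     (cmod (coord ((walk_step ^^ n) \<psi>) (k, Plus)))\<^sup>2 +
     (cmod (coord ((walk_step ^^ n) \<psi>) (k, Minus)))\<^sup>2"
  unfolding position_pmf_def
proof (rule pmf_embed_pmf)
  let ?p = "\<lambda>k. (cmod (coord ((walk_step ^^ n) \<psi>) (k, Plus)))\<^sup>2 +
     (cmod (coord ((walk_step ^^ n) \<psi>) (k, Minus)))\<^sup>2"
  have s: "(?p has_sum 1) UNIV"
    using norm_state_sq [of "(walk_step ^^ n) \<psi>"] by (simp add: norm_walk assms)
  show "0 \<le> ?p x" for x by simp
  have "Infinite_Sum.abs_summable_on ?p UNIV"
    using has_sum_imp_summable [OF s] by simp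
  then have a: "Infinite_Set_Sum.abs_summable_on ?p UNIV"
    by (simp only: abs_summable_equivalent)
  then have i: "integrable (count_space UNIV) ?p"
    by (simp only: Infinite_Set_Sum.abs_summable_on_def)
  have "(\<integral>\<^sup>+k. ennreal (?p k) \<partial>count_space UNIV) = ennreal (integral\<^sup>L (count_space UNIV) ?p)"
    by (rule nn_integral_eq_integral [OF i]) simp
  also have "integral\<^sup>L (count_space UNIV) ?p = infsetsum ?p UNIV"
    by (simp only: infsetsum_def)
  also have "\<dots> = infsum ?p UNIV"
    by (rule infsetsum_infsum [OF a])
  also have "\<dots> = 1" using s by (rule infsumI)
  finally show "(\<integral>\<^sup>+k. ennreal (?p k) \<partial>count_space UNIV) = 1" by simp
qed


section \<open>Initial measure and occupation numbers\<close>

type_synonym configuration = "state \<Rightarrow> nat"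
type_synonym occupation = "int \<Rightarrow> nat"

definition poisson :: "real \<Rightarrow> nat pmf" where
  "poisson \<alpha> = (if \<alpha> = 0 then return_pmf 0 else poisson_pmf \<alpha>)"

lemma pmf_poisson_nonneg:
  assumes "0 \<le> \<alpha>"
  shows "pmf (poisson \<alpha>) l = exp (- \<alpha>) * \<alpha> ^ l / fact l"
  using assms by (cases "\<alpha> = 0"; cases l) (simp_all add: poisson_def)

definition initial_rate :: "(real \<Rightarrow> real) \<Rightarrow> nat \<Rightarrow> state \<Rightarrow> real" where
  "initial_rate \<gamma> n \<psi> =
    (if \<exists>k s. \<psi> = ket k \<otimes>\<^sub>h ket s
     then \<gamma> (of_int (THE k. \<exists>s. \<psi> = ket k \<otimes>\<^sub>h ket s) / of_nat n) / 2 else 0)"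

lemma initial_rate_ket: "initial_rate \<gamma> n (ket k \<otimes>\<^sub>h ket s) = \<gamma> (of_int k / of_nat n) / 2"
proof -
  have "(THE k'. \<exists>s'. ket k \<otimes>\<^sub>h ket s = ket k' \<otimes>\<^sub>h ket s') = k"
    by (rule the_equality) (auto simp: tensor_ket ket_eq_iff)
  then show ?thesis by (auto simp: initial_rate_def)
qed

text \<open>The number of walks in each state is independent of the others and Poisson distributed.
  Each Poisson law is taken on its support, so that the one with parameter zero lives on \<open>{0}\<close>,
  and a configuration in the space of the product measure vanishes at all states of rate zero
  simultaneously. With \<open>UNIV\<close> as the space of every factor, the (uncountable) product
  sigma algebra would not contain this event, and the occupation numbers of the walks, which
  involve all states, would not be measurable. Under the inclusion into the product over all
  states with \<open>UNIV\<close> as the space of every factor, the measure below becomes the usual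
  product measure (lemma \<open>distr_initial_measure\<close>).\<close>

definition initial_measure :: "(real \<Rightarrow> real) \<Rightarrow> nat \<Rightarrow> configuration measure" where
  "initial_measure \<gamma> n = (\<Pi>\<^sub>M \<psi>\<in>UNIV.
     restrict_space (measure_pmf (poisson (initial_rate \<gamma> n \<psi>)))
       (set_pmf (poisson (initial_rate \<gamma> n \<psi>))))"

definition positions :: "nat \<Rightarrow> (state \<times> nat \<Rightarrow> int) measure" where
  "positions m = (\<Pi>\<^sub>M (\<psi>, j)\<in>UNIV. measure_pmf (position_pmf m \<psi>))"

definition occupation_at :: "configuration \<Rightarrow> (state \<times> nat \<Rightarrow> int) \<Rightarrow> occupation" where
  "occupation_at \<Psi> X k = (\<Sum>\<psi> | \<Psi> \<psi> \<noteq> 0. \<Sum>j = 1..\<Psi> \<psi>. of_bool (X (\<psi>, j) = k))"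

definition occupation_space :: "occupation measure" where
  "occupation_space = (\<Pi>\<^sub>M k\<in>UNIV. count_space UNIV)"

definition occupation_law :: "(real \<Rightarrow> real) \<Rightarrow> nat \<Rightarrow> nat \<Rightarrow> occupation measure" where
  "occupation_law \<gamma> n m =
    distr (initial_measure \<gamma> n \<Otimes>\<^sub>M positions m) occupation_space
      (\<lambda>(\<Psi>, X). occupation_at \<Psi> X)"

lemma prob_space_restrict_pmf: "prob_space (restrict_space (measure_pmf p) (set_pmf p))"
  by (rule prob_space_restrict_space) (simp_all add: measure_pmf.emeasure_eq_measure
      measure_pmf.prob_eq_1 AE_measure_pmf)

lemma space_initial_measure:
  "space (initial_measure \<gamma> n) = {\<Psi>. \<forall>\<psi>. \<Psi> \<psi> \<in> set_pmf (poisson (initial_rate \<gamma> n \<psi>))}"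
  by (auto simp: initial_measure_def space_PiM space_restrict_space PiE_def Pi_def)

lemma prob_space_initial_measure: "prob_space (initial_measure \<gamma> n)"
  unfolding initial_measure_def by (intro prob_space_PiM prob_space_restrict_pmf)

lemma prob_space_positions: "prob_space (positions m)"
  unfolding positions_def by (intro prob_space_PiM) (auto simp: measure_pmf.prob_space_axioms split: prod.split)

lemma measurable_configuration:
  "(\<lambda>\<Psi>. \<Psi> \<psi>) \<in> initial_measure \<gamma> n \<rightarrow>\<^sub>M count_space UNIV"
proof -
  have "(\<lambda>\<Psi>. \<Psi> \<psi>) \<in> initial_measure \<gamma> n \<rightarrow>\<^sub>M
      restrict_space (measure_pmf (poisson (initial_rate \<gamma> n \<psi>)))
        (set_pmf (poisson (initial_rate \<gamma> n \<psi>)))"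
    unfolding initial_measure_def by (rule measurable_component_singleton) simp
  from measurable_compose [OF this measurable_restrict_space1, of "\<lambda>x. x" "count_space UNIV"]
  show ?thesis by simp
qed

lemma measurable_positions: "(\<lambda>X. X p) \<in> positions m \<rightarrow>\<^sub>M count_space UNIV"
proof -
  have "(\<lambda>X. X p) \<in> positions m \<rightarrow>\<^sub>M (case p of (\<psi>, j) \<Rightarrow> measure_pmf (position_pmf m \<psi>))"
    unfolding positions_def by (rule measurable_component_singleton) simp
  then show ?thesis
    by (simp add: case_prod_unfold)
qed

lemma distr_initial_measure:
  "distr (initial_measure \<gamma> n) (\<Pi>\<^sub>M \<psi>\<in>UNIV. count_space UNIV) (\<lambda>\<Psi>. \<Psi>) =
    (\<Pi>\<^sub>M \<psi>\<in>UNIV. measure_pmf (poisson (initial_rate \<gamma> n \<psi>)))"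
proof -
  let ?p = "\<lambda>\<psi>. poisson (initial_rate \<gamma> n \<psi>)"
  let ?R = "\<lambda>\<psi>. restrict_space (measure_pmf (?p \<psi>)) (set_pmf (?p \<psi>))"
  interpret P: product_prob_space "\<lambda>\<psi>. measure_pmf (?p \<psi>)" UNIV
    by standard
  interpret R: product_prob_space ?R UNIV
    by (intro product_prob_spaceI prob_space_restrict_pmf)
  have s: "sets (\<Pi>\<^sub>M \<psi>\<in>UNIV. count_space UNIV) = sets (\<Pi>\<^sub>M \<psi>\<in>UNIV. measure_pmf (?p \<psi>))"
    by (rule sets_PiM_cong) simp_all
  show ?thesis
  proof (rule P.PiM_eq)
    show "sets (distr (initial_measure \<gamma> n) (\<Pi>\<^sub>M \<psi>\<in>UNIV. count_space UNIV) (\<lambda>\<Psi>. \<Psi>)) =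
        sets (\<Pi>\<^sub>M \<psi>\<in>UNIV. measure_pmf (?p \<psi>))"
      using s by simp
    fix J :: "state set" and F :: "state \<Rightarrow> nat set"
    assume J: "finite J" "J \<subseteq> UNIV" and F: "\<And>j. j \<in> J \<Longrightarrow> F j \<in> measure_pmf.events (?p j)"
    let ?E = "prod_emb UNIV (\<lambda>\<psi>. measure_pmf (?p \<psi>)) J (Pi\<^sub>E J F)"
    have E: "?E \<in> sets (\<Pi>\<^sub>M \<psi>\<in>UNIV. count_space UNIV)"
      unfolding s by (rule sets_PiM_I) (use J in auto)
    have m: "(\<lambda>\<Psi>. \<Psi>) \<in> initial_measure \<gamma> n \<rightarrow>\<^sub>M (\<Pi>\<^sub>M \<psi>\<in>UNIV. count_space UNIV)"
      by (rule measurable_PiM_single') (auto intro: measurable_configuration)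
    have "emeasure (distr (initial_measure \<gamma> n) (\<Pi>\<^sub>M \<psi>\<in>UNIV. count_space UNIV) (\<lambda>\<Psi>. \<Psi>)) ?E =
        emeasure (initial_measure \<gamma> n) ((\<lambda>\<Psi>. \<Psi>) -` ?E \<inter> space (initial_measure \<gamma> n))"
      using E m by (rule emeasure_distr [rotated])
    also have "(\<lambda>\<Psi>. \<Psi>) -` ?E \<inter> space (initial_measure \<gamma> n) =
        prod_emb UNIV ?R J (\<Pi>\<^sub>E \<psi>\<in>J. F \<psi> \<inter> set_pmf (?p \<psi>))"
      by (auto simp: prod_emb_def space_initial_measure space_restrict_space PiE_def Pi_def
          restrict_def extensional_def)
    also have "emeasure (initial_measure \<gamma> n) \<dots> =
        (\<Prod>\<psi>\<in>J. emeasure (?R \<psi>) (F \<psi> \<inter> set_pmf (?p \<psi>)))"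
      unfolding initial_measure_def
      by (rule R.emeasure_PiM_emb) (use J in \<open>auto simp: sets_restrict_space\<close>)
    also have "\<dots> = (\<Prod>\<psi>\<in>J. emeasure (measure_pmf (?p \<psi>)) (F \<psi>))"
      by (rule prod.cong)
        (simp_all add: emeasure_restrict_space emeasure_Int_set_pmf)
    finally show "emeasure (distr (initial_measure \<gamma> n) (\<Pi>\<^sub>M \<psi>\<in>UNIV. count_space UNIV) (\<lambda>\<Psi>. \<Psi>)) ?E =
        (\<Prod>\<psi>\<in>J. emeasure (measure_pmf (?p \<psi>)) (F \<psi>))" .
  qed
qed

lemma finite_support_initial_rate:
  assumes "compact (closure {y. \<gamma> y \<noteq> 0})" and "n > 0"
  shows "finite {\<psi>. initial_rate \<gamma> n \<psi> \<noteq> 0}"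
proof -
  have "bounded {y. \<gamma> y \<noteq> 0}"
    using assms(1) by (metis bounded_subset closure_subset compact_imp_bounded)
  then obtain B where B: "\<And>y. \<gamma> y \<noteq> 0 \<Longrightarrow> \<bar>y\<bar> \<le> B"
    by (auto simp: bounded_iff)
  have "k \<in> {- \<lceil>B * n\<rceil>..\<lceil>B * n\<rceil>}" if "\<gamma> (of_int k / of_nat n) \<noteq> 0" for k
  proof -
    have "\<bar>of_int k / real n\<bar> \<le> B"
      by (rule B [OF that])
    then have "\<bar>of_int k\<bar> \<le> B * real n"
      using \<open>n > 0\<close> by (simp add: abs_divide divide_le_eq)
    then have "\<bar>k\<bar> \<le> \<lceil>B * real n\<rceil>"
      by linarith
    then show ?thesis by auto
  qed
  note * = this
  have "{\<psi>. initial_rate \<gamma> n \<psi> \<noteq> 0} \<subseteq>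
      (\<lambda>(k, s). ket k \<otimes>\<^sub>h ket s) ` ({- \<lceil>B * n\<rceil>..\<lceil>B * n\<rceil>} \<times> UNIV)"
  proof
    fix \<psi> assume \<psi>: "\<psi> \<in> {\<psi>. initial_rate \<gamma> n \<psi> \<noteq> 0}"
    then obtain k s where ks: "\<psi> = ket k \<otimes>\<^sub>h ket s"
      by (auto simp: initial_rate_def split: if_splits)
    with \<psi> have "k \<in> {- \<lceil>B * n\<rceil>..\<lceil>B * n\<rceil>}"
      by (intro *) (simp add: initial_rate_ket)
    with ks show "\<psi> \<in> (\<lambda>(k, s). ket k \<otimes>\<^sub>h ket s) ` ({- \<lceil>B * n\<rceil>..\<lceil>B * n\<rceil>} \<times> UNIV)"
      by (intro image_eqI [of _ _ "(k, s)"]) simp_all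
  qed
  then show ?thesis
    by (rule finite_subset) simp
qed

lemma configuration_support:
  assumes "\<Psi> \<in> space (initial_measure \<gamma> n)"
  shows "{\<psi>. \<Psi> \<psi> \<noteq> 0} \<subseteq> {\<psi>. initial_rate \<gamma> n \<psi> \<noteq> 0}"
proof
  fix \<psi> assume "\<psi> \<in> {\<psi>. \<Psi> \<psi> \<noteq> 0}"
  moreover have "\<Psi> \<psi> \<in> set_pmf (poisson (initial_rate \<gamma> n \<psi>))"
    using assms by (simp add: space_initial_measure)
  ultimately show "\<psi> \<in> {\<psi>. initial_rate \<gamma> n \<psi> \<noteq> 0}"
    by (auto simp: poisson_def split: if_splits)
qed

lemma measurable_occupation_at:
  assumes "compact (closure {y. \<gamma> y \<noteq> 0})" and "n > 0"
  shows "(\<lambda>(\<Psi>, X). occupation_at \<Psi> X) \<in>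
    initial_measure \<gamma> n \<Otimes>\<^sub>M positions m \<rightarrow>\<^sub>M occupation_space"
  unfolding occupation_space_def
proof (rule measurable_PiM_single')
  fix k :: int
  let ?S = "{\<psi>. initial_rate \<gamma> n \<psi> \<noteq> 0}"
  let ?M = "initial_measure \<gamma> n \<Otimes>\<^sub>M positions m"
  have "(\<lambda>\<omega>. (\<Sum>j = 1..fst \<omega> \<psi>. of_bool (snd \<omega> (\<psi>, j) = k)) :: nat) \<in> ?M \<rightarrow>\<^sub>M count_space UNIV" for \<psi>
  proof (rule measurable_compose_countable [where g = "\<lambda>\<omega>. fst \<omega> \<psi>"])
    show "(\<lambda>\<omega>. (\<Sum>j = 1..i. of_bool (snd \<omega> (\<psi>, j) = k)) :: nat) \<in> ?M \<rightarrow>\<^sub>M count_space UNIV" for i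
    proof (intro measurable_sum_nat)
      fix j
      have "(\<lambda>\<omega>. snd \<omega> (\<psi>, j)) \<in> ?M \<rightarrow>\<^sub>M count_space UNIV"
        by (rule measurable_compose [OF measurable_snd measurable_positions])
      from measurable_compose [OF this, of "\<lambda>z. of_bool (z = k) :: nat" "count_space UNIV"]
      show "(\<lambda>\<omega>. of_bool (snd \<omega> (\<psi>, j) = k) :: nat) \<in> ?M \<rightarrow>\<^sub>M count_space UNIV"
        by simp
    qed
    show "(\<lambda>\<omega>. fst \<omega> \<psi>) \<in> ?M \<rightarrow>\<^sub>M count_space UNIV"
      by (rule measurable_compose [OF measurable_fst measurable_configuration])
  qed
  then have *: "(\<lambda>\<omega>. (\<Sum>\<psi>\<in>?S. \<Sum>j = 1..fst \<omega> \<psi>. of_bool (snd \<omega> (\<psi>, j) = k)) :: nat)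
      \<in> ?M \<rightarrow>\<^sub>M count_space UNIV"
    by (intro measurable_sum_nat)
  have eq: "(case \<omega> of (\<Psi>, X) \<Rightarrow> occupation_at \<Psi> X) k =
      (\<Sum>\<psi>\<in>?S. \<Sum>j = 1..fst \<omega> \<psi>. of_bool (snd \<omega> (\<psi>, j) = k))" if "\<omega> \<in> space ?M" for \<omega>
  proof -
    from that have "fst \<omega> \<in> space (initial_measure \<gamma> n)"
      by (auto simp: space_pair_measure)
    from configuration_support [OF this] show ?thesis
      unfolding occupation_at_def case_prod_unfold
      by (intro sum.mono_neutral_left finite_support_initial_rate assms) auto
  qed
  show "(\<lambda>\<omega>. (case \<omega> of (\<Psi>, X) \<Rightarrow> occupation_at \<Psi> X) k) \<in> ?M \<rightarrow>\<^sub>M count_space UNIV"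
    by (subst measurable_cong [OF eq]) (use * in auto)
qed auto

lemma prob_space_occupation_law:
  assumes "compact (closure {y. \<gamma> y \<noteq> 0})" and "n > 0"
  shows "prob_space (occupation_law \<gamma> n m)"
proof -
  interpret pair_prob_space "initial_measure \<gamma> n" "positions m"
    by (intro pair_prob_space.intro pair_sigma_finite.intro prob_space_initial_measure
        prob_space_positions prob_space_imp_sigma_finite)
  show ?thesis
    unfolding occupation_law_def by (intro prob_space_distr measurable_occupation_at assms)
qed


section \<open>Topology, translations and Poisson product measures\<close>

definition occupation_dist :: "occupation \<Rightarrow> occupation \<Rightarrow> real" where
  "occupation_dist \<eta> \<zeta> = (\<Sum>\<^sub>\<infinity>k. (1/2) ^ nat \<bar>k\<bar> *
     (\<bar>real (\<eta> k) - real (\<zeta> k)\<bar> / (1 + \<bar>real (\<eta> k) - real (\<zeta> k)\<bar>)))"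

definition occupation_topology :: "occupation topology" where
  "occupation_topology = Metric_space.mtopology UNIV occupation_dist"

definition weakly_converges :: "(nat \<Rightarrow> occupation measure) \<Rightarrow> occupation measure \<Rightarrow> bool" where
  "weakly_converges \<mu> \<nu> \<longleftrightarrow>
    (\<forall>g. continuous_map occupation_topology euclideanreal g \<and> bounded (range g) \<longrightarrow>
      (\<lambda>n. \<integral>\<eta>. g \<eta> \<partial>\<mu> n) \<longlonglongrightarrow> (\<integral>\<eta>. g \<eta> \<partial>\<nu>))"

definition translate :: "int \<Rightarrow> occupation measure \<Rightarrow> occupation measure" where
  "translate k \<mu> = distr \<mu> occupation_space (\<lambda>\<eta> j. \<eta> (j + k))"

definition poisson_product :: "real \<Rightarrow> occupation measure" where
  "poisson_product \<alpha> = (\<Pi>\<^sub>M k\<in>UNIV. measure_pmf (poisson \<alpha>))"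

definition konno_density :: "real \<Rightarrow> real" where
  "konno_density x =
    (if x \<in> {- (sqrt 2 / 2)<..<sqrt 2 / 2} then 1 / (pi * (1 - x\<^sup>2) * sqrt (1 - 2 * x\<^sup>2)) else 0)"

definition limit_profile :: "(real \<Rightarrow> real) \<Rightarrow> real \<Rightarrow> real \<Rightarrow> real" where
  "limit_profile \<gamma> t x = (\<integral>y. \<gamma> y * (1 / t * konno_density ((x - y) / t)) \<partial>lborel)"

lemma summable_weights: "(\<lambda>k::int. (1/2::real) ^ nat \<bar>k\<bar>) summable_on UNIV"
proof -
  let ?w = "\<lambda>k::int. (1/2::real) ^ nat \<bar>k\<bar>"
  have g: "(\<lambda>n. (1/2::real) ^ n) summable_on UNIV"
    by (subst summable_on_UNIV_nonneg_real_iff) (simp_all add: summable_geometric)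
  have "?w summable_on range int" "?w summable_on range (\<lambda>n. - int n)"
    by (subst summable_on_reindex; simp add: inj_on_def o_def g)+
  then have "?w summable_on (range int \<union> range (\<lambda>n. - int n))"
    by (rule summable_on_union)
  moreover have "range int \<union> range (\<lambda>n. - int n) = UNIV"
  proof (intro equalityI subset_UNIV subsetI)
    fix k :: int
    show "k \<in> range int \<union> range (\<lambda>n. - int n)"
      by (cases k rule: int_cases2) auto
  qed
  ultimately show ?thesis by simp
qed

definition excess :: "real \<Rightarrow> real" where
  "excess a = \<bar>a\<bar> / (1 + \<bar>a\<bar>)"

lemma excess_bounds: "0 \<le> excess a" "excess a \<le> 1" "excess (- a) = excess a" "excess a = 0 \<longleftrightarrow> a = 0"
  by (auto simp: excess_def field_simps)

lemma excess_triangle: "excess (a + b) \<le> excess a + excess b"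
proof -
  have mono: "u / (1 + u) \<le> v / (1 + v)" if "0 \<le> u" "u \<le> v" for u v :: real
    using that by (simp add: divide_simps) (simp add: algebra_simps)
  have "excess (a + b) \<le> (\<bar>a\<bar> + \<bar>b\<bar>) / (1 + (\<bar>a\<bar> + \<bar>b\<bar>))"
    unfolding excess_def by (rule mono) (simp_all add: abs_triangle_ineq)
  also have "\<dots> = \<bar>a\<bar> / (1 + (\<bar>a\<bar> + \<bar>b\<bar>)) + \<bar>b\<bar> / (1 + (\<bar>a\<bar> + \<bar>b\<bar>))"
    by (rule add_divide_distrib)
  also have "\<dots> \<le> excess a + excess b"
    unfolding excess_def by (intro add_mono divide_left_mono) auto
  finally show ?thesis .
qed

lemma occupation_dist_excess:
  "occupation_dist \<eta> \<zeta> = (\<Sum>\<^sub>\<infinity>k. (1/2) ^ nat \<bar>k\<bar> * excess (real (\<eta> k) - real (\<zeta> k)))"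
  by (simp only: occupation_dist_def excess_def)

lemma summable_dist: "(\<lambda>k. (1/2) ^ nat \<bar>k\<bar> * excess (real (\<eta> k) - real (\<zeta> k))) summable_on UNIV"
  by (rule summable_on_comparison_test [OF summable_weights])
    (auto simp: excess_bounds mult_left_le)

lemma dist_ge_coord: "(1/2) ^ nat \<bar>k\<bar> * excess (real (\<eta> k) - real (\<zeta> k)) \<le> occupation_dist \<eta> \<zeta>"
proof -
  have "(\<Sum>k\<in>{k}. (1/2) ^ nat \<bar>k\<bar> * excess (real (\<eta> k) - real (\<zeta> k))) \<le> occupation_dist \<eta> \<zeta>"
    unfolding occupation_dist_excess
    by (rule finite_sum_le_infsum [OF summable_dist]) (auto simp: excess_bounds)
  then show ?thesis by simp
qed

lemma Metric_space_occupation: "Metric_space UNIV occupation_dist"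
proof
  fix \<eta> \<zeta> \<xi> :: occupation
  show "0 \<le> occupation_dist \<eta> \<zeta>"
    unfolding occupation_dist_excess by (rule infsum_nonneg) (simp add: excess_bounds)
  show "occupation_dist \<eta> \<zeta> = occupation_dist \<zeta> \<eta>"
    by (simp only: occupation_dist_def abs_minus_commute)
  show "occupation_dist \<eta> \<zeta> = 0 \<longleftrightarrow> \<eta> = \<zeta>"
  proof
    assume *: "occupation_dist \<eta> \<zeta> = 0"
    have "excess (real (\<eta> k) - real (\<zeta> k)) = 0" for k
    proof (rule ccontr)
      assume "excess (real (\<eta> k) - real (\<zeta> k)) \<noteq> 0"
      then have "0 < excess (real (\<eta> k) - real (\<zeta> k))"
        using excess_bounds(1) [of "real (\<eta> k) - real (\<zeta> k)"] by linarith
      then have "0 < (1/2) ^ nat \<bar>k\<bar> * excess (real (\<eta> k) - real (\<zeta> k))"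
        by simp
      with dist_ge_coord [of k \<eta> \<zeta>] * show False by linarith
    qed
    then show "\<eta> = \<zeta>"
      by (auto simp: excess_bounds)
  qed (simp add: occupation_dist_def)
  have "occupation_dist \<eta> \<xi> \<le> (\<Sum>\<^sub>\<infinity>k. (1/2) ^ nat \<bar>k\<bar> * excess (real (\<eta> k) - real (\<zeta> k)) +
      (1/2) ^ nat \<bar>k\<bar> * excess (real (\<zeta> k) - real (\<xi> k)))"
    unfolding occupation_dist_excess
  proof (intro infsum_mono summable_on_add summable_dist)
    fix k
    have "excess (real (\<eta> k) - real (\<xi> k)) \<le>
        excess (real (\<eta> k) - real (\<zeta> k)) + excess (real (\<zeta> k) - real (\<xi> k))"
      using excess_triangle [of "real (\<eta> k) - real (\<zeta> k)" "real (\<zeta> k) - real (\<xi> k)"] by simp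
    then show "(1/2) ^ nat \<bar>k\<bar> * excess (real (\<eta> k) - real (\<xi> k)) \<le>
        (1/2) ^ nat \<bar>k\<bar> * excess (real (\<eta> k) - real (\<zeta> k)) +
        (1/2) ^ nat \<bar>k\<bar> * excess (real (\<zeta> k) - real (\<xi> k))"
      by (simp add: distrib_left [symmetric])
  qed
  also have "\<dots> = occupation_dist \<eta> \<zeta> + occupation_dist \<zeta> \<xi>"
    unfolding occupation_dist_excess by (rule infsum_add [OF summable_dist summable_dist])
  finally show "occupation_dist \<eta> \<xi> \<le> occupation_dist \<eta> \<zeta> + occupation_dist \<zeta> \<xi>" .
qed

lemma dist_le_of_agree:
  assumes "r > 0"
  obtains F where "finite F" "\<And>\<eta> \<zeta>. (\<And>k. k \<in> F \<Longrightarrow> \<eta> k = \<zeta> k) \<Longrightarrow> occupation_dist \<eta> \<zeta> \<le> r"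
proof -
  let ?w = "\<lambda>k::int. (1/2::real) ^ nat \<bar>k\<bar>"
  obtain F where F: "finite F" "dist (sum ?w F) (infsum ?w UNIV) \<le> r"
    using infsum_finite_approximation [OF summable_weights assms] by auto
  have "occupation_dist \<eta> \<zeta> \<le> r" if *: "\<And>k. k \<in> F \<Longrightarrow> \<eta> k = \<zeta> k" for \<eta> \<zeta>
  proof -
    have W: "?w summable_on (UNIV - F)"
      using summable_weights by (rule summable_on_subset_banach) simp
    have "occupation_dist \<eta> \<zeta> \<le> infsum ?w (UNIV - F)"
      unfolding occupation_dist_excess
      by (rule infsum_mono_neutral [OF summable_dist W])
        (auto simp: * excess_bounds mult_left_le excess_bounds(4) [of 0, THEN iffD2])
    also have "\<dots> = infsum ?w UNIV - infsum ?w F"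
      by (rule infsum_Diff [OF summable_weights]) (use F in auto)
    also have "\<dots> \<le> r"
      using F by (auto simp: dist_real_def)
    finally show ?thesis .
  qed
  with F that show ?thesis by blast
qed

text \<open>The metric induces the product topology, and its Borel sets are the sets of the product
  sigma algebra.\<close>

lemma occupation_topology_eq: "occupation_topology = euclidean"
proof -
  interpret Metric_space UNIV occupation_dist
    by (rule Metric_space_occupation)
  have "openin mtopology U \<longleftrightarrow> open U" for U
  proof
    assume U: "openin mtopology U"
    show "open U"
    proof (subst open_subopen, intro ballI)
      fix \<eta> assume "\<eta> \<in> U"
      with U obtain r where r: "r > 0" "mball \<eta> r \<subseteq> U"
        by (auto simp: openin_mtopology)
      from r(1) have "r / 2 > 0" by simp
      then obtain F where F: "finite F" "\<And>\<eta> \<zeta>. (\<And>k. k \<in> F \<Longrightarrow> \<eta> k = \<zeta> k) \<Longrightarrow> occupation_dist \<eta> \<zeta> \<le> r / 2"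
        by (rule dist_le_of_agree) blast
      let ?X = "\<lambda>k. if k \<in> F then {\<eta> k} else UNIV"
      have "open (Pi\<^sub>E UNIV ?X)"
        by (rule open_PiE) (simp_all add: F(1) discrete_topology_class.open_discrete)
      moreover have "\<eta> \<in> Pi\<^sub>E UNIV ?X" by auto
      moreover have "Pi\<^sub>E UNIV ?X \<subseteq> U"
      proof
        fix \<zeta> assume "\<zeta> \<in> Pi\<^sub>E UNIV ?X"
        then have "\<And>k. k \<in> F \<Longrightarrow> \<eta> k = \<zeta> k"
          by (auto simp: PiE_def Pi_def split: if_splits)
        then have "occupation_dist \<eta> \<zeta> \<le> r / 2"
          by (rule F(2))
        with r show "\<zeta> \<in> U"
          by (auto simp: mball_def subset_iff)
      qed
      ultimately show "\<exists>T. open T \<and> \<eta> \<in> T \<and> T \<subseteq> U" by blast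
    qed
  next
    assume U: "open U"
    have "\<exists>r>0. mball \<eta> r \<subseteq> U" if "\<eta> \<in> U" for \<eta>
    proof -
      from U have "openin (product_topology (\<lambda>_. euclidean) UNIV) U"
        by (simp add: open_fun_def)
      from product_topology_open_contains_basis [OF this that] obtain X where
        X: "\<eta> \<in> Pi\<^sub>E UNIV X" "finite {k. X k \<noteq> UNIV}" "Pi\<^sub>E UNIV X \<subseteq> U"
        by auto
      let ?K = "{k. X k \<noteq> UNIV}"
      define r where "r = Min (insert 1 ((\<lambda>k. (1/2::real) ^ nat \<bar>k\<bar> * (1/2)) ` ?K))"
      have r: "r > 0" "\<And>k. k \<in> ?K \<Longrightarrow> r \<le> (1/2) ^ nat \<bar>k\<bar> * (1/2)"
        unfolding r_def by (subst Min_gr_iff; use X(2) in force) (rule Min_le; use X(2) in blast)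
      have "\<zeta> \<in> U" if z: "occupation_dist \<eta> \<zeta> < r" for \<zeta>
      proof -
        have "\<zeta> k = \<eta> k" if k: "k \<in> ?K" for k
        proof (rule ccontr)
          assume "\<zeta> k \<noteq> \<eta> k"
          then have "\<bar>real (\<eta> k) - real (\<zeta> k)\<bar> \<ge> 1" by linarith
          then have "excess (real (\<eta> k) - real (\<zeta> k)) \<ge> 1/2"
            by (simp add: excess_def divide_simps)
          then have "(1/2) ^ nat \<bar>k\<bar> * (1/2) \<le> (1/2) ^ nat \<bar>k\<bar> * excess (real (\<eta> k) - real (\<zeta> k))"
            by (intro mult_left_mono) auto
          with r(2) [OF k] dist_ge_coord [of k \<eta> \<zeta>] z show False by linarith
        qed
        with X(1) have "\<zeta> \<in> Pi\<^sub>E UNIV X"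
          by (force simp: PiE_def Pi_def)
        with X(3) show ?thesis by blast
      qed
      with r(1) show ?thesis by (auto simp: mball_def)
    qed
    then show "openin mtopology U"
      by (auto simp: openin_mtopology)
  qed
  then show ?thesis
    unfolding occupation_topology_def by (simp add: topology_eq)
qed

lemma sets_occupation_space: "sets occupation_space = sets borel"
proof -
  have "sets occupation_space = sets (\<Pi>\<^sub>M k\<in>(UNIV :: int set). (borel :: nat measure))"
    unfolding occupation_space_def by (rule sets_PiM_cong) (simp_all add: sets_borel_eq_count_space)
  then show ?thesis
    by (simp add: sets_PiM_equal_borel)
qed

lemma integral_translate:
  assumes "sets \<mu> = sets occupation_space" and "continuous_map occupation_topology euclideanreal g"
  shows "(\<integral>\<eta>. g \<eta> \<partial>translate k \<mu>) = (\<integral>\<eta>. g (\<lambda>j. \<eta> (j + k)) \<partial>\<mu>)"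
  unfolding translate_def
proof (rule integral_distr)
  show "g \<in> borel_measurable occupation_space"
    using assms(2) unfolding measurable_cong_sets [OF sets_occupation_space refl] occupation_topology_eq
    by (intro borel_measurable_continuous_onI) simp
  have "(\<lambda>\<eta> j. \<eta> (j + k)) \<in> occupation_space \<rightarrow>\<^sub>M occupation_space"
    unfolding occupation_space_def by (intro measurable_PiM_single' measurable_component_singleton) auto
  then show "(\<lambda>\<eta> j. \<eta> (j + k)) \<in> \<mu> \<rightarrow>\<^sub>M occupation_space"
    by (simp only: measurable_cong_sets [OF assms(1) refl])
qed

end

theory Submission
  imports Defs "HOL-Real_Asymp.Real_Asymp"
begin

text \<open>
  Poisson systems stay Poisson under independent motion. If the numbers of walks in the basis
  states are independent Poisson variables and every walk is observed at an independent random
  position, then, by thinning and superposition, the numbers of walks seen at the different sites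
  are again independent Poisson variables, exactly and at every time. Hence the law of the
  occupation numbers at time \<open>m\<close> is determined by its means, and the mean at site \<open>k\<close> is
  \<open>site_rate\<close>, the expectation of \<open>\<gamma> ((k - D) / n)\<close> where \<open>D\<close> is the displacement after \<open>m\<close> steps
  of a walk whose initial coin state is a fair mixture. Cylinder probabilities are continuous
  functions of finitely many of these means, so the theorem reduces to two facts: convergence of
  cylinder probabilities implies weak convergence (\<open>weakly_converges_cylinders\<close>), and the means
  converge to \<open>limit_profile\<close> (\<open>site_rate_tendsto\<close>).

  The means converge because \<open>D / m\<close> converges in law to the density \<open>konno_density\<close>
  (\<open>scaled_walk_converges\<close>). In Fourier space one step of the walk is multiplication by \<open>\<i> V\<close>
  with \<open>V \<theta>\<close> in \<open>SU(2)\<close>, a rotation by the angle \<open>phase \<theta>\<close>; thus \<open>m\<close> steps are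
  \<open>\<i> ^ m (cos (m phase \<theta>) + sin (m phase \<theta>) bloch \<theta>)\<close>, where \<open>bloch \<theta>\<close> squares to \<open>- 1\<close>.
  By Parseval's identity the characteristic function of \<open>D / m\<close> at \<open>\<xi>\<close> is the mean over the circle of
  half the trace of the product of the adjoint of this matrix at \<open>\<theta>\<close> with the same matrix at
  \<open>\<theta> + \<xi> / m\<close>. As \<open>m\<close> grows the two axes coincide, only the difference
  \<open>m (phase (\<theta> + \<xi> / m) - phase \<theta>)\<close> of the angles matters, and it tends to \<open>\<xi>\<close> times the derivative
  \<open>group_velocity \<theta>\<close> of the phase. So \<open>D / m\<close> behaves like the group velocity at a uniformly
  distributed \<open>\<theta>\<close>, and the change of variables \<open>v = group_velocity \<theta>\<close> produces \<open>konno_density\<close>.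

  That the occupation numbers are independent Poisson variables is read off from their joint
  probability generating function (\<open>integral_occupation_pgf\<close>), which factorizes because all the
  randomness is independent and the generating function of a Poisson law is an exponential; and a joint
  generating function determines the joint law (\<open>joint_pgf_determines_masses\<close>).
\<close>

section \<open>The Hadamard walk in Fourier space\<close>

text \<open>The anti-Hermitian matrix with square \<open>- 1\<close> along which the one-step matrix rotates: that matrix,
  with rows \<open>(cis \<theta>, cis \<theta>) / sqrt 2\<close> for \<open>Plus\<close> and \<open>(cis (- \<theta>), - cis (- \<theta>)) / sqrt 2\<close> for \<open>Minus\<close>, equals
  \<open>\<i> (cos (phase \<theta>) + sin (phase \<theta>) bloch \<theta>)\<close>. The denominator is \<open>sqrt 2 sin (phase \<theta>)\<close>, which never
  vanishes, so no eigenvalues cross.\<close>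

definition bloch :: "real \<Rightarrow> coin \<Rightarrow> coin \<Rightarrow> complex" where
  "bloch \<theta> s r = \<i> / of_real (sqrt (1 + (cos \<theta>)\<^sup>2)) *
     (case s of
        Plus \<Rightarrow> (case r of Plus \<Rightarrow> - of_real (cos \<theta>) | Minus \<Rightarrow> - cis \<theta>)
      | Minus \<Rightarrow> (case r of Plus \<Rightarrow> - cis (- \<theta>) | Minus \<Rightarrow> of_real (cos \<theta>)))"

text \<open>The one-step matrix divided by \<open>\<i>\<close> has determinant \<open>1\<close> and trace \<open>sqrt 2 sin \<theta>\<close>, that is,
  eigenvalues \<open>cis (\<plusminus> phase \<theta>)\<close>.\<close>

definition phase :: "real \<Rightarrow> real" where
  "phase \<theta> = arccos (sin \<theta> / sqrt 2)"

text \<open>The Fourier transform of the amplitudes after \<open>m\<close> steps from the origin with coin state \<open>r\<close>, in the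
  closed form that powers of a rotation have; \<open>has_sum_amplitude\<close> identifies the two.\<close>

definition wave :: "nat \<Rightarrow> coin \<Rightarrow> real \<Rightarrow> coin \<Rightarrow> complex" where
  "wave m r \<theta> s = \<i> ^ m *
     (of_real (cos (real m * phase \<theta>)) * of_bool (s = r) + of_real (sin (real m * phase \<theta>)) * bloch \<theta> s r)"

lemma abs_sin_div_sqrt2: "\<bar>sin \<theta> / sqrt 2\<bar> < 1"
proof -
  have "\<bar>sin \<theta>\<bar> / sqrt 2 \<le> 1 / sqrt 2"
    by (intro divide_right_mono) auto
  also have "\<dots> < 1" by simp
  finally show ?thesis by (simp add: abs_divide)
qed

lemma cos_phase: "cos (phase \<theta>) = sin \<theta> / sqrt 2"
  unfolding phase_def using abs_sin_div_sqrt2[of \<theta>] by (intro cos_arccos) linarith+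

lemma sin_phase: "sin (phase \<theta>) = sqrt (1 + (cos \<theta>)\<^sup>2) / sqrt 2"
proof -
  have "sin (phase \<theta>) = sqrt (1 - (sin \<theta> / sqrt 2)\<^sup>2)"
    unfolding phase_def using abs_sin_div_sqrt2[of \<theta>] by (intro sin_arccos) linarith+
  also have "1 - (sin \<theta> / sqrt 2)\<^sup>2 = (1 + (cos \<theta>)\<^sup>2) / 2"
    by (simp add: power_divide cos_squared_eq field_simps)
  finally show ?thesis by (simp add: real_sqrt_divide)
qed

lemma phase_deriv:
  "(phase has_real_derivative - cos \<theta> / sqrt (1 + (cos \<theta>)\<^sup>2)) (at \<theta>)"
proof -
  have "(phase has_real_derivative inverse (- sqrt (1 - (sin \<theta> / sqrt 2)\<^sup>2)) * (cos \<theta> / sqrt 2)) (at \<theta>)"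
    unfolding phase_def using abs_sin_div_sqrt2[of \<theta>]
    by (intro DERIV_chain2 [where f = arccos] DERIV_arccos DERIV_cdivide DERIV_sin) linarith+
  moreover have "1 - (sin \<theta> / sqrt 2)\<^sup>2 = (1 + (cos \<theta>)\<^sup>2) / 2"
    by (simp add: power_divide cos_squared_eq field_simps)
  moreover have "inverse (- sqrt ((1 + (cos \<theta>)\<^sup>2) / 2)) * (cos \<theta> / sqrt 2) = - cos \<theta> / sqrt (1 + (cos \<theta>)\<^sup>2)"
    by (simp add: real_sqrt_divide divide_simps)
  ultimately show ?thesis by simp
qed

text \<open>The four matrix entries of the identity
  \<open>\<i> (cos \<phi> + sin \<phi> N) (C + S N) = \<i> ((C cos \<phi> - S sin \<phi>) + (S cos \<phi> + C sin \<phi>) N)\<close> for \<open>N = bloch \<theta>\<close>,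
  with the left factor written out as the one-step matrix. Here \<open>c\<close> and \<open>s\<close> stand for the cosine and sine
  of \<open>\<theta>\<close>, \<open>d\<close> for \<open>sqrt (1 + c\<^sup>2)\<close> \<open>p\<close> for \<open>sqrt 2\<close> and \<open>j\<close> for \<open>\<i>\<close>.\<close>

lemma bloch_algebra:
  fixes j c s d p C S :: complex
  assumes "j * j = - 1" "d * d = 1 + c * c" "s * s = 1 - c * c" "d \<noteq> 0" "p \<noteq> 0"
  shows "j * ((C * s / p - S * d / p) + (S * s / p + C * d / p) * (j / d * - c)) =
      (c + j * s) * ((C + S * (j / d * - c)) + S * (j / d * - (c - j * s))) / p"
    and "j * ((S * s / p + C * d / p) * (j / d * - (c + j * s))) =
      (c + j * s) * (S * (j / d * - (c + j * s)) + (C + S * (j / d * c))) / p"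
    and "j * ((S * s / p + C * d / p) * (j / d * - (c - j * s))) =
      (c - j * s) * ((C + S * (j / d * - c)) - S * (j / d * - (c - j * s))) / p"
    and "j * ((C * s / p - S * d / p) + (S * s / p + C * d / p) * (j / d * c)) =
      (c - j * s) * (S * (j / d * - (c + j * s)) - (C + S * (j / d * c))) / p"
  using assms(4,5) by (simp_all add: divide_simps) (use assms(1-3) in algebra)+

lemma wave_Suc:
  "wave (Suc m) r \<theta> Plus = cis \<theta> * (wave m r \<theta> Plus + wave m r \<theta> Minus) / sqrt 2"
  "wave (Suc m) r \<theta> Minus = cis (- \<theta>) * (wave m r \<theta> Plus - wave m r \<theta> Minus) / sqrt 2"
proof -
  define d where "d = complex_of_real (sqrt (1 + (cos \<theta>)\<^sup>2))"
  define c where "c = complex_of_real (cos \<theta>)"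
  define s where "s = complex_of_real (sin \<theta>)"
  define p where "p = complex_of_real (sqrt 2)"
  define C where "C = complex_of_real (cos (m * phase \<theta>))"
  define S where "S = complex_of_real (sin (m * phase \<theta>))"
  have "sqrt (1 + (cos \<theta>)\<^sup>2) * sqrt (1 + (cos \<theta>)\<^sup>2) = 1 + cos \<theta> * cos \<theta>"
    by (simp add: power2_eq_square)
  then have d: "d * d = 1 + c * c"
    unfolding d_def c_def by (simp only: of_real_mult [symmetric] of_real_add of_real_1)
  have "sin \<theta> * sin \<theta> = 1 - cos \<theta> * cos \<theta>"
    using sin_squared_eq [of \<theta>] by (simp add: power2_eq_square)
  then have s: "s * s = 1 - c * c"
    unfolding s_def c_def by (simp only: of_real_mult [symmetric] of_real_diff of_real_1)
  have "sqrt (1 + (cos \<theta>)\<^sup>2) \<noteq> 0"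
    using add_pos_nonneg [OF zero_less_one zero_le_power2 [of "cos \<theta>"]] by simp
  then have d0: "d \<noteq> 0" by (simp add: d_def del: real_sqrt_eq_zero_cancel_iff)
  have p0: "p \<noteq> 0" by (simp add: p_def)
  have e: "cis \<theta> = c + \<i> * s" "cis (- \<theta>) = c - \<i> * s"
    by (simp_all add: c_def s_def complex_eq_iff)
  have C': "complex_of_real (cos (real (Suc m) * phase \<theta>)) = C * s / p - S * d / p"
    unfolding C_def S_def s_def d_def p_def
    by (simp add: distrib_right cos_add cos_phase sin_phase algebra_simps)
  have S': "complex_of_real (sin (real (Suc m) * phase \<theta>)) = S * s / p + C * d / p"
    unfolding C_def S_def s_def d_def p_def
    by (simp add: distrib_right sin_add cos_phase sin_phase algebra_simps)
  note alg = bloch_algebra [OF i_squared d s d0 p0, where C = C and S = S]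
  have lift: "\<i> ^ Suc m * x = a * (\<i> ^ m * y + \<i> ^ m * z) / p" if "\<i> * x = a * (y + z) / p"
    for x y z a
    using that [THEN arg_cong, of "\<lambda>u. \<i> ^ m * u"] by (simp add: algebra_simps add_divide_distrib)
  have lift': "\<i> ^ Suc m * x = a * (\<i> ^ m * y - \<i> ^ m * z) / p" if "\<i> * x = a * (y - z) / p"
    for x y z a
    using that [THEN arg_cong, of "\<lambda>u. \<i> ^ m * u"] by (simp add: algebra_simps diff_divide_distrib)
  note unf = wave_def bloch_def C' S' C_def [symmetric] S_def [symmetric] d_def [symmetric]
    c_def [symmetric] p_def [symmetric] e
  show "wave (Suc m) r \<theta> Plus = cis \<theta> * (wave m r \<theta> Plus + wave m r \<theta> Minus) / sqrt 2"
    unfolding unf by (rule lift, cases r) (use alg(1,2) in simp_all)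
  show "wave (Suc m) r \<theta> Minus = cis (- \<theta>) * (wave m r \<theta> Plus - wave m r \<theta> Minus) / sqrt 2"
    unfolding unf by (rule lift', cases r) (use alg(3,4) in simp_all)
qed

lemma coord_walk_step:
  "coord (walk_step \<psi>) (k, Plus) = (coord \<psi> (k - 1, Plus) + coord \<psi> (k - 1, Minus)) / sqrt 2"
  "coord (walk_step \<psi>) (k, Minus) = (coord \<psi> (k + 1, Plus) - coord \<psi> (k + 1, Minus)) / sqrt 2"
  by (simp_all add: walk_step_def coin_shift.rep_eq id_tensor_hadamard.rep_eq unshift_def sum_coin
      hadamard_entry_def add_divide_distrib diff_divide_distrib)

definition amplitude :: "nat \<Rightarrow> coin \<Rightarrow> int \<Rightarrow> coin \<Rightarrow> complex" where
  "amplitude m r k s = coord ((walk_step ^^ m) (ket 0 \<otimes>\<^sub>h ket r)) (k, s)"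

lemma coord_walk_ket:
  "coord ((walk_step ^^ m) (ket j \<otimes>\<^sub>h ket r)) (k, s) = amplitude m r (k - j) s"
proof (induction m arbitrary: k s)
  case 0
  show ?case by (simp add: amplitude_def tensor_ket coord_ket)
next
  case (Suc m)
  have *: "k + 1 - j = k - j + 1" "k - 1 - j = k - j - 1" by simp_all
  from Suc show ?case
    by (cases s) (simp_all add: amplitude_def coord_walk_step *)
qed

lemma amplitude_eq_0: "int m < \<bar>k\<bar> \<Longrightarrow> amplitude m r k s = 0"
proof (induction m arbitrary: k s)
  case 0
  then show ?case by (auto simp: amplitude_def tensor_ket coord_ket)
next
  case (Suc m)
  then have "int m < \<bar>k - 1\<bar>" "int m < \<bar>k + 1\<bar>" by auto
  with Suc.IH show ?case
    by (cases s) (simp_all add: amplitude_def coord_walk_step)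
qed

text \<open>Both sides obey the same recursion: shifting a coin component in space multiplies its Fourier
  transform by \<open>cis (\<plusminus> \<theta>)\<close>.\<close>

lemma has_sum_amplitude:
  "((\<lambda>k. amplitude m r k s * cis (of_int k * \<theta>)) has_sum wave m r \<theta> s) UNIV"
proof (induction m arbitrary: s)
  case 0
  have "((\<lambda>k. amplitude 0 r k s * cis (of_int k * \<theta>)) has_sum (\<Sum>k\<in>{0}. amplitude 0 r k s * cis (of_int k * \<theta>))) UNIV"
    by (rule has_sum_finite_neutralI [OF _ _ _ refl]) (auto simp: amplitude_def tensor_ket coord_ket)
  then show ?case
    by (cases "s = r") (simp_all add: wave_def amplitude_def tensor_ket coord_ket)
next
  case (Suc m)
  let ?f = "\<lambda>s k. amplitude m r k s * cis (of_int k * \<theta>)"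
  have sh: "((\<lambda>k. ?f s (k + c)) has_sum wave m r \<theta> s) UNIV" for s c
    using Suc[of s] by (subst has_sum_reindex_bij_betw[where g = "\<lambda>k. k + c" and A = UNIV and B = UNIV and f = "?f s"])
      (auto intro: bij_plus_right)
  have e: "cis (of_int k * \<theta>) = cis \<theta> * cis (of_int (k - 1) * \<theta>)"
    "cis (of_int k * \<theta>) = cis (- \<theta>) * cis (of_int (k + 1) * \<theta>)" for k :: int
    by (simp_all add: cis_mult algebra_simps)
  show ?case
  proof (cases s)
    case Plus
    have "((\<lambda>k. (cis \<theta> / sqrt 2) * (?f Plus (k + (-1)) + ?f Minus (k + (-1)))) has_sum
      (cis \<theta> / sqrt 2) * (wave m r \<theta> Plus + wave m r \<theta> Minus)) UNIV"
      by (intro has_sum_cmult_right has_sum_add sh)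
    moreover have "(cis \<theta> / sqrt 2) * (?f Plus (k + (-1)) + ?f Minus (k + (-1))) = amplitude (Suc m) r k s * cis (of_int k * \<theta>)" for k
      by (subst e(1)) (simp add: amplitude_def coord_walk_step Plus algebra_simps add_divide_distrib)
    ultimately show ?thesis by (simp add: wave_Suc Plus)
  next
    case Minus
    have "((\<lambda>k. (cis (- \<theta>) / sqrt 2) * (?f Plus (k + 1) + - ?f Minus (k + 1))) has_sum
      (cis (- \<theta>) / sqrt 2) * (wave m r \<theta> Plus + - wave m r \<theta> Minus)) UNIV"
      by (intro has_sum_cmult_right has_sum_add sh has_sum_uminusI)
    moreover have "(cis (- \<theta>) / sqrt 2) * (?f Plus (k + 1) + - ?f Minus (k + 1)) = amplitude (Suc m) r k s * cis (of_int k * \<theta>)" for k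
      by (subst e(2)) (simp add: amplitude_def coord_walk_step Minus algebra_simps diff_divide_distrib)
    ultimately show ?thesis by (simp add: wave_Suc Minus)
  qed
qed

lemma wave_eq_sum:
  "wave m r \<theta> s = (\<Sum>k\<in>{- int m..int m}. amplitude m r k s * cis (of_int k * \<theta>))"
proof -
  have "((\<lambda>k. amplitude m r k s * cis (of_int k * \<theta>)) has_sum
      (\<Sum>k\<in>{- int m..int m}. amplitude m r k s * cis (of_int k * \<theta>))) UNIV"
  proof (rule has_sum_finite_neutralI)
    fix k assume "k \<in> UNIV - {- int m..int m}"
    then have "int m < \<bar>k\<bar>" by auto
    then show "amplitude m r k s * cis (of_int k * \<theta>) = 0" by (simp add: amplitude_eq_0)
  qed auto
  with has_sum_amplitude show ?thesis by (rule has_sum_unique)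
qed

definition circle :: "real measure" where
  "circle = restrict_space lborel {- pi..pi}"

lemma finite_measure_circle: "finite_measure circle"
  by (rule finite_measureI) (simp add: circle_def emeasure_restrict_space)

lemma integral_circle:
  fixes f :: "real \<Rightarrow> 'b::{banach, second_countable_topology}"
  shows "(\<integral>\<theta>. f \<theta> \<partial>circle) = (\<integral>\<theta>. indicator {- pi..pi} \<theta> *\<^sub>R f \<theta> \<partial>lborel)"
  unfolding circle_def by (rule integral_restrict_space) simp

lemma integrable_circle:
  fixes f :: "real \<Rightarrow> 'b::euclidean_space"
  assumes "continuous_on {- pi..pi} f"
  shows "integrable circle f"
proof -
  have "set_integrable lborel {- pi..pi} f"
    using assms by (rule borel_integrable_atLeastAtMost')
  then show ?thesis
    by (simp add: circle_def integrable_restrict_space set_integrable_def)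
qed

lemma integral_cis_circle:
  "(\<integral>\<theta>. cis (of_int n * \<theta>) \<partial>circle) = (if n = 0 then of_real (2 * pi) else 0)"
proof (cases "n = 0")
  case True
  have "measure circle (space circle) = 2 * pi"
    by (simp add: circle_def measure_restrict_space)
  then show ?thesis
    by (simp add: True scaleR_conv_of_real)
next
  case False
  have "(\<integral>\<theta>. indicator {- pi..pi} \<theta> *\<^sub>R cis (of_int n * \<theta>) \<partial>lborel)
      = cis (of_int n * pi) / (\<i> * of_int n) - cis (of_int n * (- pi)) / (\<i> * of_int n)"
  proof (rule integral_FTC_atLeastAtMost)
    fix x
    have "((\<lambda>x. cis (of_int n * x)) has_vector_derivative (of_int n *\<^sub>R (\<i> * cis (of_int n * x)))) (at x within {- pi..pi})"
      unfolding cis_conv_exp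
      by (auto intro!: derivative_eq_intros has_vector_derivative_real_field simp: scaleR_conv_of_real)
    from has_vector_derivative_divide [OF this, of "\<i> * of_int n"] False
    show "((\<lambda>x. cis (of_int n * x) / (\<i> * of_int n)) has_vector_derivative cis (of_int n * x)) (at x within {- pi..pi})"
      by (simp add: scaleR_conv_of_real)
  qed (auto intro!: continuous_intros)
  also have "cis (of_int n * (- pi)) = cis (of_int n * pi)"
    by (simp add: complex_eq_iff sin_times_pi_eq_0)
  finally show ?thesis using False by (simp add: integral_circle)
qed

text \<open>Translating the Fourier variable by \<open>\<delta>\<close> modulates the amplitudes, so the polarized form of
  Parseval's identity gives the characteristic function of the squared amplitudes.\<close>

lemma parseval_wave:
  "(\<integral>\<theta>. cnj (wave m r \<theta> s) * wave m r (\<theta> + \<delta>) s \<partial>circle) =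
    of_real (2 * pi) * (\<Sum>k\<in>{- int m..int m}. of_real ((cmod (amplitude m r k s))\<^sup>2) * cis (of_int k * \<delta>))"
proof -
  let ?K = "{- int m..int m}"
  let ?a = "\<lambda>k. amplitude m r k s"
  have "cnj (wave m r \<theta> s) * wave m r (\<theta> + \<delta>) s =
      (\<Sum>j\<in>?K. \<Sum>k\<in>?K. cnj (?a j) * ?a k * cis (of_int k * \<delta>) * cis (of_int (k - j) * \<theta>))" for \<theta>
    unfolding wave_eq_sum cnj_sum sum_product
    by (intro sum.cong refl) (simp add: cis_cnj cis_mult algebra_simps)
  then have "(\<integral>\<theta>. cnj (wave m r \<theta> s) * wave m r (\<theta> + \<delta>) s \<partial>circle) =
      (\<integral>\<theta>. (\<Sum>j\<in>?K. \<Sum>k\<in>?K. cnj (?a j) * ?a k * cis (of_int k * \<delta>) * cis (of_int (k - j) * \<theta>)) \<partial>circle)"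
    by simp
  also have "\<dots> = (\<Sum>j\<in>?K. \<Sum>k\<in>?K. cnj (?a j) * ?a k * cis (of_int k * \<delta>) * (\<integral>\<theta>. cis (of_int (k - j) * \<theta>) \<partial>circle))"
    by (subst Bochner_Integration.integral_sum | intro sum.cong refl Bochner_Integration.integrable_sum
        integrable_circle continuous_intros | simp)+
  also have "\<dots> = (\<Sum>j\<in>?K. \<Sum>k\<in>?K. if k = j then of_real (2 * pi) * (cnj (?a k) * ?a k * cis (of_int k * \<delta>)) else 0)"
    by (intro sum.cong refl) (simp only: integral_cis_circle, simp)
  also have "\<dots> = of_real (2 * pi) * (\<Sum>k\<in>?K. of_real ((cmod (?a k))\<^sup>2) * cis (of_int k * \<delta>))"
    by (simp add: sum_distrib_left complex_norm_square mult.commute mult.left_commute del: of_real_power)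
  finally show ?thesis .
qed

text \<open>Minus half the trace of \<open>bloch \<theta> bloch \<theta>'\<close>, the cosine of the angle between the two rotation axes.\<close>

definition bloch_overlap :: "real \<Rightarrow> real \<Rightarrow> real" where
  "bloch_overlap \<theta> \<theta>' = (cos \<theta> * cos \<theta>' + cos (\<theta> - \<theta>')) / (sqrt (1 + (cos \<theta>)\<^sup>2) * sqrt (1 + (cos \<theta>')\<^sup>2))"

lemma wave_overlap:
  "(\<Sum>r\<in>UNIV. \<Sum>s\<in>UNIV. cnj (wave m r \<theta> s) * wave m r \<theta>' s) =
    of_real (2 * cos (real m * phase \<theta>) * cos (real m * phase \<theta>') +
      2 * sin (real m * phase \<theta>) * sin (real m * phase \<theta>') * bloch_overlap \<theta> \<theta>')"
proof -
  define d d' where "d = sqrt (1 + (cos \<theta>)\<^sup>2)" and "d' = sqrt (1 + (cos \<theta>')\<^sup>2)"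
  define C S where "C = cos (real m * phase \<theta>)" and "S = sin (real m * phase \<theta>)"
  define C' S' where "C' = cos (real m * phase \<theta>')" and "S' = sin (real m * phase \<theta>')"
  have pw: "cnj (\<i> ^ m * x) * (\<i> ^ m * y) = cnj x * y" for x y
  proof -
    have "cnj (\<i> ^ m) * \<i> ^ m = (cnj \<i> * \<i>) ^ m" by (simp only: complex_cnj_power power_mult_distrib)
    also have "\<dots> = 1" by simp
    finally show ?thesis by (simp add: algebra_simps)
  qed
  have d0: "d \<noteq> 0" "d' \<noteq> 0"
    using add_pos_nonneg [OF zero_less_one zero_le_power2 [of "cos \<theta>"]]
      add_pos_nonneg [OF zero_less_one zero_le_power2 [of "cos \<theta>'"]] by (simp_all add: d_def d'_def)
  show ?thesis
    unfolding sum_coin wave_def pw bloch_def bloch_overlap_def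
      d_def [symmetric] d'_def [symmetric] C_def [symmetric] S_def [symmetric] C'_def [symmetric] S'_def [symmetric]
    using d0 by (simp add: complex_eq_iff cos_diff Re_divide Im_divide field_simps power2_eq_square)
qed


section \<open>The limit law of the scaled displacement\<close>

definition walk_pmf :: "nat \<Rightarrow> int pmf" where
  "walk_pmf m = bind_pmf (pmf_of_set UNIV) (\<lambda>r. position_pmf m (ket 0 \<otimes>\<^sub>h ket r))"

lemma pmf_position_ket:
  "pmf (position_pmf m (ket j \<otimes>\<^sub>h ket r)) k = (\<Sum>s\<in>UNIV. (cmod (amplitude m r (k - j) s))\<^sup>2)"
  by (simp add: pmf_position tensor_ket norm_ket sum_coin coord_walk_ket [unfolded tensor_ket])

lemma pmf_walk:
  "pmf (walk_pmf m) k = (\<Sum>r\<in>UNIV. \<Sum>s\<in>UNIV. (cmod (amplitude m r k s))\<^sup>2) / 2"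
proof -
  have "card (UNIV :: coin set) = 2" by (simp add: UNIV_coin)
  then show ?thesis
    by (simp add: walk_pmf_def pmf_bind_pmf_of_set pmf_position_ket)
qed

lemma set_walk_pmf: "set_pmf (walk_pmf m) \<subseteq> {- int m..int m}"
proof
  fix k assume "k \<in> set_pmf (walk_pmf m)"
  then have "pmf (walk_pmf m) k \<noteq> 0" by (simp add: set_pmf_iff)
  then have "\<not> int m < \<bar>k\<bar>" by (auto simp: pmf_walk amplitude_eq_0)
  then show "k \<in> {- int m..int m}" by auto
qed

definition scaled_walk :: "nat \<Rightarrow> real measure" where
  "scaled_walk m = distr (measure_pmf (walk_pmf m)) borel (\<lambda>k. of_int k / real m)"

lemma real_distribution_scaled_walk: "real_distribution (scaled_walk m)"
  unfolding scaled_walk_def real_distribution_def real_distribution_axioms_def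
  by (simp add: measure_pmf.prob_space_distr)

text \<open>The trace formula: summing Parseval's identity over both coin indices.\<close>

lemma char_scaled_walk:
  "char (scaled_walk m) \<xi> = of_real (1 / (2 * pi)) * of_real (\<integral>\<theta>.
    cos (real m * phase \<theta>) * cos (real m * phase (\<theta> + \<xi> / real m)) +
    sin (real m * phase \<theta>) * sin (real m * phase (\<theta> + \<xi> / real m)) * bloch_overlap \<theta> (\<theta> + \<xi> / real m) \<partial>circle)"
  (is "_ = _ * of_real (\<integral>\<theta>. ?g \<theta> \<partial>circle)")
proof -
  let ?\<delta> = "\<xi> / real m"
  let ?K = "{- int m..int m}"
  have "char (scaled_walk m) \<xi> = (\<integral>k. cis (of_int k * ?\<delta>) \<partial>measure_pmf (walk_pmf m))"
    by (simp add: char_def scaled_walk_def integral_distr cis_conv_exp mult.commute)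
  also have "\<dots> = (\<Sum>k\<in>?K. pmf (walk_pmf m) k *\<^sub>R cis (of_int k * ?\<delta>))"
    by (rule integral_measure_pmf) (use set_walk_pmf [of m] in auto)
  also have "\<dots> = (\<Sum>r\<in>UNIV. \<Sum>s\<in>UNIV. \<Sum>k\<in>?K. of_real ((cmod (amplitude m r k s))\<^sup>2) * cis (of_int k * ?\<delta>)) / 2"
    by (simp add: pmf_walk sum_coin scaleR_conv_of_real sum_divide_distrib sum.distrib algebra_simps add_divide_distrib)
  also have "\<dots> = (\<Sum>r\<in>UNIV. \<Sum>s\<in>UNIV. (\<integral>\<theta>. cnj (wave m r \<theta> s) * wave m r (\<theta> + ?\<delta>) s \<partial>circle)) / of_real (4 * pi)"
    by (simp add: parseval_wave sum_distrib_left [symmetric])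
  also have "(\<Sum>r\<in>UNIV. \<Sum>s\<in>UNIV. (\<integral>\<theta>. cnj (wave m r \<theta> s) * wave m r (\<theta> + ?\<delta>) s \<partial>circle))
      = (\<integral>\<theta>. (\<Sum>r\<in>UNIV. \<Sum>s\<in>UNIV. cnj (wave m r \<theta> s) * wave m r (\<theta> + ?\<delta>) s) \<partial>circle)"
    unfolding wave_eq_sum
    by (subst Bochner_Integration.integral_sum | intro sum.cong refl Bochner_Integration.integrable_sum
        integrable_circle continuous_intros | simp)+
  also have "\<dots> = of_real (2 * (\<integral>\<theta>. ?g \<theta> \<partial>circle))"
    unfolding wave_overlap integral_complex_of_real
    by (simp add: algebra_simps flip: Bochner_Integration.integral_mult_right_zero)
  finally show ?thesis by (simp add: field_simps)
qed

text \<open>The derivative of \<open>phase\<close>, by \<open>phase_deriv\<close>.\<close>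

definition group_velocity :: "real \<Rightarrow> real" where
  "group_velocity \<theta> = - cos \<theta> / sqrt (1 + (cos \<theta>)\<^sup>2)"

lemma one_plus_cos_sq_pos: "0 < 1 + (cos \<theta>)\<^sup>2" for \<theta> :: real
  by (intro add_pos_nonneg) auto

lemma tendsto_phase_increment:
  "(\<lambda>m. real m * (phase (\<theta> + \<xi> / real m) - phase \<theta>)) \<longlonglongrightarrow> \<xi> * group_velocity \<theta>"
proof (cases "\<xi> = 0")
  case False
  have "((\<lambda>h. (phase (\<theta> + h) - phase \<theta>) / h) \<longlongrightarrow> group_velocity \<theta>) (at 0)"
    using phase_deriv [of \<theta>] by (simp add: DERIV_def group_velocity_def)
  moreover have "filterlim (\<lambda>m. \<xi> / real m) (at 0) sequentially"
    unfolding filterlim_at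
    by (intro conjI lim_const_over_n eventually_sequentiallyI [of 1]) (use False in auto)
  ultimately have "(\<lambda>m. (phase (\<theta> + \<xi> / real m) - phase \<theta>) / (\<xi> / real m)) \<longlonglongrightarrow> group_velocity \<theta>"
    by (rule filterlim_compose)
  from tendsto_mult_left [OF this, of \<xi>] False show ?thesis
    by (simp add: mult.commute)
qed simp

lemma tendsto_bloch_overlap: "(\<lambda>m. bloch_overlap \<theta> (\<theta> + \<xi> / real m)) \<longlonglongrightarrow> 1"
proof -
  have t: "(\<lambda>m. \<theta> + \<xi> / real m) \<longlonglongrightarrow> \<theta>"
    using tendsto_add [OF tendsto_const lim_const_over_n] by force
  have "(\<lambda>m. bloch_overlap \<theta> (\<theta> + \<xi> / real m)) \<longlonglongrightarrow>
      (cos \<theta> * cos \<theta> + cos (\<theta> - \<theta>)) / (sqrt (1 + (cos \<theta>)\<^sup>2) * sqrt (1 + (cos \<theta>)\<^sup>2))"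
    unfolding bloch_overlap_def
    by (intro tendsto_intros t) (use one_plus_cos_sq_pos [of \<theta>] in auto)
  also have "(cos \<theta> * cos \<theta> + cos (\<theta> - \<theta>)) / (sqrt (1 + (cos \<theta>)\<^sup>2) * sqrt (1 + (cos \<theta>)\<^sup>2)) = 1"
    using one_plus_cos_sq_pos [of \<theta>] by (simp add: power2_eq_square)
  finally show ?thesis .
qed

lemma abs_bloch_overlap_le: "\<bar>bloch_overlap \<theta> \<theta>'\<bar> \<le> 2"
proof -
  have "\<bar>cos \<theta> * cos \<theta>' + cos (\<theta> - \<theta>')\<bar> \<le> 1 * 1 + 1"
    by (intro order_trans [OF abs_triangle_ineq] add_mono) (simp_all add: abs_mult mult_le_one)
  moreover have "1 * 1 \<le> sqrt (1 + (cos \<theta>)\<^sup>2) * sqrt (1 + (cos \<theta>')\<^sup>2)"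
    by (intro mult_mono) auto
  ultimately have "\<bar>cos \<theta> * cos \<theta>' + cos (\<theta> - \<theta>')\<bar> \<le> 2 * (sqrt (1 + (cos \<theta>)\<^sup>2) * sqrt (1 + (cos \<theta>')\<^sup>2))"
    by linarith
  then show ?thesis
    using one_plus_cos_sq_pos [of \<theta>] one_plus_cos_sq_pos [of \<theta>']
    by (simp add: bloch_overlap_def abs_divide divide_le_eq abs_mult)
qed

lemma continuous_phase: "continuous_on A phase"
  by (intro continuous_at_imp_continuous_on ballI DERIV_isCont [OF phase_deriv])

text \<open>Once the overlap of the axes is replaced by its limit \<open>1\<close>, the integrand is the cosine of the
  difference of the angles, and this difference converges pointwise.\<close>

lemma char_scaled_walk_tendsto:
  "(\<lambda>m. char (scaled_walk m) \<xi>) \<longlonglongrightarrow>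
    of_real (1 / (2 * pi)) * of_real (\<integral>\<theta>. cos (\<xi> * group_velocity \<theta>) \<partial>circle)"
  unfolding char_scaled_walk
proof (intro tendsto_mult tendsto_const tendsto_of_real)
  let ?a = "\<lambda>m \<theta>. real m * phase \<theta>" and ?b = "\<lambda>m \<theta>. real m * phase (\<theta> + \<xi> / real m)"
  let ?K = "\<lambda>m \<theta>. bloch_overlap \<theta> (\<theta> + \<xi> / real m)"
  interpret finite_measure circle by (rule finite_measure_circle)
  have m_borel: "f \<in> borel_measurable circle" if "continuous_on UNIV f" for f :: "real \<Rightarrow> real"
    unfolding circle_def using that by (intro measurable_restrict_space1) (simp add: borel_measurable_continuous_onI)
  show "(\<lambda>m. \<integral>\<theta>. cos (?a m \<theta>) * cos (?b m \<theta>) + sin (?a m \<theta>) * sin (?b m \<theta>) * ?K m \<theta> \<partial>circle)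
      \<longlonglongrightarrow> (\<integral>\<theta>. cos (\<xi> * group_velocity \<theta>) \<partial>circle)"
  proof (rule integral_dominated_convergence [where w = "\<lambda>_. 3"])
    show "(\<lambda>\<theta>. cos (\<xi> * group_velocity \<theta>)) \<in> borel_measurable circle"
      unfolding group_velocity_def using one_plus_cos_sq_pos
      by (intro m_borel continuous_intros) (auto simp: less_imp_neq [symmetric])
    show "(\<lambda>\<theta>. cos (?a m \<theta>) * cos (?b m \<theta>) + sin (?a m \<theta>) * sin (?b m \<theta>) * ?K m \<theta>) \<in> borel_measurable circle" for m
      unfolding bloch_overlap_def using one_plus_cos_sq_pos
      by (intro m_borel continuous_intros continuous_on_compose2 [OF continuous_phase [of UNIV]])
        (auto simp: less_imp_neq [symmetric])
    show "AE \<theta> in circle. norm (cos (?a m \<theta>) * cos (?b m \<theta>) + sin (?a m \<theta>) * sin (?b m \<theta>) * ?K m \<theta>) \<le> 3" for m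
    proof (intro AE_I2)
      fix \<theta>
      have "\<bar>cos (?a m \<theta>) * cos (?b m \<theta>)\<bar> \<le> 1 * 1"
        unfolding abs_mult by (intro mult_mono) auto
      moreover have "\<bar>sin (?a m \<theta>) * sin (?b m \<theta>) * ?K m \<theta>\<bar> \<le> 1 * 1 * 2"
        unfolding abs_mult by (intro mult_mono abs_bloch_overlap_le) auto
      ultimately show "norm (cos (?a m \<theta>) * cos (?b m \<theta>) + sin (?a m \<theta>) * sin (?b m \<theta>) * ?K m \<theta>) \<le> 3"
        unfolding real_norm_def by linarith
    qed
    show "AE \<theta> in circle. (\<lambda>m. cos (?a m \<theta>) * cos (?b m \<theta>) + sin (?a m \<theta>) * sin (?b m \<theta>) * ?K m \<theta>)
        \<longlonglongrightarrow> cos (\<xi> * group_velocity \<theta>)"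
    proof (intro AE_I2)
      fix \<theta>
      \<comment> \<open>The error made by treating the two rotation axes as equal.\<close>
      have "(\<lambda>m. sin (?a m \<theta>) * sin (?b m \<theta>) * (?K m \<theta> - 1)) \<longlonglongrightarrow> 0"
      proof (rule Lim_null_comparison)
        show "\<forall>\<^sub>F m in sequentially. norm (sin (?a m \<theta>) * sin (?b m \<theta>) * (?K m \<theta> - 1)) \<le> 1 * 1 * \<bar>?K m \<theta> - 1\<bar>"
          unfolding real_norm_def abs_mult by (intro always_eventually allI mult_mono) auto
        show "(\<lambda>m. 1 * 1 * \<bar>?K m \<theta> - 1\<bar>) \<longlonglongrightarrow> 0"
          using tendsto_rabs [OF tendsto_diff [OF tendsto_bloch_overlap tendsto_const, of \<theta> \<xi> 1]] by simp
      qed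
      moreover have "(\<lambda>m. cos (real m * (phase (\<theta> + \<xi> / real m) - phase \<theta>))) \<longlonglongrightarrow> cos (\<xi> * group_velocity \<theta>)"
        by (intro tendsto_cos tendsto_phase_increment)
      ultimately have "(\<lambda>m. cos (?b m \<theta> - ?a m \<theta>) + sin (?a m \<theta>) * sin (?b m \<theta>) * (?K m \<theta> - 1))
          \<longlonglongrightarrow> cos (\<xi> * group_velocity \<theta>) + 0"
        by (intro tendsto_add) (simp_all add: algebra_simps)
      then show "(\<lambda>m. cos (?a m \<theta>) * cos (?b m \<theta>) + sin (?a m \<theta>) * sin (?b m \<theta>) * ?K m \<theta>)
          \<longlonglongrightarrow> cos (\<xi> * group_velocity \<theta>)"
        by (simp add: cos_diff algebra_simps)
    qed
  qed simp
qed

definition konno :: "real measure" where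
  "konno = density lborel (\<lambda>v. ennreal (konno_density v))"

lemma konno_density_nonneg: "0 \<le> konno_density v"
proof (cases "v \<in> {- (sqrt 2 / 2)<..<sqrt 2 / 2}")
  case True
  then have "\<bar>v\<bar> < sqrt 2 / 2"
    unfolding greaterThanLessThan_iff by linarith
  then have "v\<^sup>2 < (sqrt 2 / 2)\<^sup>2" using power_strict_mono[of "\<bar>v\<bar>" _ 2] by simp
  then have "v\<^sup>2 < 1 / 2" by (simp add: power_divide)
  then show ?thesis by (simp add: konno_density_def)
qed (auto simp: konno_density_def)

lemma measurable_konno_density [measurable]: "konno_density \<in> borel_measurable borel"
  unfolding konno_density_def by measurable

lemma konno_density_minus: "konno_density (- v) = konno_density v"
  by (auto simp: konno_density_def)

lemma group_velocity_deriv: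
  "(group_velocity has_real_derivative sin \<theta> / ((1 + (cos \<theta>)\<^sup>2) * sqrt (1 + (cos \<theta>)\<^sup>2))) (at \<theta>)"
proof -
  define q where "q = sqrt (1 + (cos \<theta>)\<^sup>2)"
  have q0: "q \<noteq> 0" and qq: "1 + (cos \<theta>)\<^sup>2 = q\<^sup>2"
    using one_plus_cos_sq_pos [of \<theta>] by (simp_all add: q_def)
  have "((\<lambda>\<theta>. 1 + (cos \<theta>)\<^sup>2) has_real_derivative - 2 * cos \<theta> * sin \<theta>) (at \<theta>)"
    by (rule DERIV_cong [OF DERIV_add [OF DERIV_const DERIV_power [OF DERIV_cos, of 2]]]) simp
  note d = DERIV_chain2 [where f = sqrt and g = "\<lambda>\<theta>. 1 + (cos \<theta>)\<^sup>2",
      OF DERIV_real_sqrt [OF one_plus_cos_sq_pos [of \<theta>]] this]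
  have "inverse q / 2 * (- 2 * cos \<theta> * sin \<theta>) = - (cos \<theta> * sin \<theta>) / q"
    by (simp add: inverse_eq_divide)
  with d have "((\<lambda>\<theta>. sqrt (1 + (cos \<theta>)\<^sup>2)) has_real_derivative - (cos \<theta> * sin \<theta>) / q) (at \<theta>)"
    by (simp only: q_def)
  moreover have "((\<lambda>\<theta>. - cos \<theta>) has_real_derivative sin \<theta>) (at \<theta>)"
    using DERIV_minus [OF DERIV_cos, of \<theta>] by simp
  ultimately have "(group_velocity has_real_derivative
      (sin \<theta> * q - - cos \<theta> * (- (cos \<theta> * sin \<theta>) / q)) / (q * q)) (at \<theta>)"
    unfolding group_velocity_def using q0 unfolding q_def by (intro DERIV_divide) auto
  also have "(sin \<theta> * q - - cos \<theta> * (- (cos \<theta> * sin \<theta>) / q)) / (q * q) = sin \<theta> * (q\<^sup>2 - (cos \<theta>)\<^sup>2) / (q\<^sup>2 * q)"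
    using q0 by (simp add: field_simps power2_eq_square)
  also have "q\<^sup>2 - (cos \<theta>)\<^sup>2 = 1" using qq by simp
  finally show ?thesis unfolding q_def [symmetric] unfolding qq by simp
qed

text \<open>On \<open>(0, pi)\<close> the group velocity is strictly increasing and its derivative is exactly the reciprocal of
  \<open>pi * konno_density\<close>: with \<open>q\<^sup>2 = 1 + (cos \<theta>)\<^sup>2\<close> one has \<open>1 - v\<^sup>2 = 1 / q\<^sup>2\<close> and
  \<open>1 - 2 v\<^sup>2 = (sin \<theta> / q)\<^sup>2\<close> for \<open>v = group_velocity \<theta>\<close>.\<close>

lemma konno_density_group_velocity:
  assumes "0 < \<theta>" "\<theta> < pi"
  shows "konno_density (group_velocity \<theta>) * (sin \<theta> / ((1 + (cos \<theta>)\<^sup>2) * sqrt (1 + (cos \<theta>)\<^sup>2))) = 1 / pi"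
proof -
  define q where "q = sqrt (1 + (cos \<theta>)\<^sup>2)"
  have q0: "0 < q" and qq: "q\<^sup>2 = 1 + (cos \<theta>)\<^sup>2"
    using one_plus_cos_sq_pos [of \<theta>] by (simp_all add: q_def)
  have s: "0 < sin \<theta>" using assms by (rule sin_gt_zero)
  have g2: "(group_velocity \<theta>)\<^sup>2 = (cos \<theta>)\<^sup>2 / q\<^sup>2"
    by (simp add: group_velocity_def q_def power_divide)
  have c2: "(cos \<theta>)\<^sup>2 = q\<^sup>2 - 1" and s2: "(sin \<theta>)\<^sup>2 = 2 - q\<^sup>2"
    using qq by (simp_all add: sin_squared_eq)
  have "1 - 2 * (group_velocity \<theta>)\<^sup>2 = (sin \<theta> / q)\<^sup>2"
    using q0 unfolding g2 c2 power_divide s2 by (simp add: diff_divide_distrib)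
  then have r: "sqrt (1 - 2 * (group_velocity \<theta>)\<^sup>2) = sin \<theta> / q"
    by (simp only: real_sqrt_abs) (use s q0 in simp)
  have i: "1 - (group_velocity \<theta>)\<^sup>2 = 1 / q\<^sup>2"
    using q0 unfolding g2 c2 by (simp add: diff_divide_distrib)
  have "0 < sqrt (1 - 2 * (group_velocity \<theta>)\<^sup>2)"
    unfolding r using s q0 by (rule divide_pos_pos)
  then have "0 < 1 - 2 * (group_velocity \<theta>)\<^sup>2"
    by (simp only: real_sqrt_gt_0_iff)
  then have "(group_velocity \<theta>)\<^sup>2 < (sqrt 2 / 2)\<^sup>2"
    by (simp add: power_divide)
  then have "\<bar>group_velocity \<theta>\<bar> < sqrt 2 / 2"
    by (intro power2_less_imp_less [of "\<bar>group_velocity \<theta>\<bar>"]) (simp_all only: power2_abs, simp)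
  then have "group_velocity \<theta> \<in> {- (sqrt 2 / 2)<..<sqrt 2 / 2}" by auto
  then have "konno_density (group_velocity \<theta>) = 1 / (pi * (1 / q\<^sup>2) * (sin \<theta> / q))"
    by (simp only: konno_density_def r i if_True)
  then show ?thesis
    unfolding q_def [symmetric] unfolding qq [symmetric] using q0 s by simp
qed

text \<open>The uniform probability on half a period, where the group velocity is injective.\<close>

definition half_circle :: "real measure" where
  "half_circle = density lborel (\<lambda>\<theta>. ennreal (1 / pi) * indicator {0..pi} \<theta>)"

lemma sets_half_circle [measurable_cong]: "sets half_circle = sets borel"
  by (simp add: half_circle_def)

lemma continuous_group_velocity: "continuous_on A group_velocity"
  by (intro continuous_at_imp_continuous_on ballI DERIV_isCont [OF group_velocity_deriv])

lemma measurable_group_velocity [measurable]: "group_velocity \<in> borel_measurable borel"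
  by (intro borel_measurable_continuous_onI continuous_group_velocity)

text \<open>Change of variables in the Lebesgue integral. At the end points \<open>konno_density\<close> is zero by
  definition while the uniform density is \<open>1 / pi\<close>, so the integrands agree only almost everywhere.\<close>

lemma konno_eq_distr: "konno = distr half_circle borel group_velocity"
proof (rule measure_eqI)
  fix A assume "A \<in> sets konno"
  then have A [measurable]: "A \<in> sets borel" by (simp add: konno_def)
  let ?g' = "\<lambda>\<theta>. sin \<theta> / ((1 + (cos \<theta>)\<^sup>2) * sqrt (1 + (cos \<theta>)\<^sup>2))"
  let ?f = "\<lambda>v. konno_density v * indicator A v"
  have ends: "group_velocity 0 = - (sqrt 2 / 2)" "group_velocity pi = sqrt 2 / 2"
    by (simp_all add: group_velocity_def divide_simps)
  have "emeasure konno A = (\<integral>\<^sup>+v. ennreal (?f v * indicator {group_velocity 0..group_velocity pi} v) \<partial>lborel)"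
    unfolding konno_def ends
    by (subst emeasure_density) (auto simp: konno_density_def intro!: nn_integral_cong split: split_indicator)
  also have "\<dots> = (\<integral>\<^sup>+\<theta>. ennreal (?f (group_velocity \<theta>) * ?g' \<theta> * indicator {0..pi} \<theta>) \<partial>lborel)"
  proof (rule nn_integral_substitution)
    show "set_borel_measurable borel {group_velocity 0..group_velocity pi} ?f"
      unfolding set_borel_measurable_def by measurable
    show "continuous_on {0..pi} ?g'"
      using one_plus_cos_sq_pos by (intro continuous_intros) (auto simp: less_imp_neq [symmetric])
  qed (auto intro!: group_velocity_deriv divide_nonneg_nonneg sin_ge_zero)
  also have "\<dots> = (\<integral>\<^sup>+\<theta>. ennreal (1 / pi) * indicator {0..pi} \<theta> * indicator A (group_velocity \<theta>) \<partial>lborel)"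
  proof (rule nn_integral_cong_AE)
    have "AE \<theta> in lborel. \<theta> \<noteq> (0::real)" "AE \<theta> in lborel. \<theta> \<noteq> pi"
      by (simp_all add: AE_lborel_singleton)
    then show "AE \<theta> in lborel. ennreal (?f (group_velocity \<theta>) * ?g' \<theta> * indicator {0..pi} \<theta>) =
        ennreal (1 / pi) * indicator {0..pi} \<theta> * indicator A (group_velocity \<theta>)"
    proof eventually_elim
      case (elim \<theta>)
      then show ?case
        using konno_density_group_velocity [of \<theta>] by (auto split: split_indicator)
    qed
  qed
  also have "\<dots> = emeasure (distr half_circle borel group_velocity) A"
    using measurable_sets [OF measurable_group_velocity A] unfolding half_circle_def
    by (simp add: emeasure_distr emeasure_density indicator_def)
  finally show "emeasure konno A = emeasure (distr half_circle borel group_velocity) A" .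
qed (simp add: konno_def)

lemma prob_space_half_circle: "prob_space half_circle"
proof (rule prob_spaceI)
  have "emeasure half_circle (space half_circle) = ennreal (1 / pi) * ennreal pi"
    unfolding half_circle_def by (simp add: emeasure_density nn_integral_cmult)
  also have "\<dots> = 1" by (simp flip: ennreal_mult)
  finally show "emeasure half_circle (space half_circle) = 1" .
qed

lemma real_distribution_konno: "real_distribution konno"
  unfolding konno_eq_distr real_distribution_def real_distribution_axioms_def
  by (auto intro!: prob_space.prob_space_distr prob_space_half_circle)

lemma integral_konno:
  fixes h :: "real \<Rightarrow> real"
  assumes "h \<in> borel_measurable borel"
  shows "(\<integral>v. h v \<partial>konno) = (\<integral>v. h v * konno_density v \<partial>lborel)"
  using assms
  unfolding konno_def by (subst integral_density) (auto simp: konno_density_nonneg mult.commute)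

lemma integral_half_circle:
  fixes h :: "real \<Rightarrow> real"
  assumes "continuous_on UNIV h" "\<And>\<theta>. h (- \<theta>) = h \<theta>"
  shows "(\<integral>\<theta>. h \<theta> \<partial>half_circle) = 1 / (2 * pi) * (\<integral>\<theta>. h \<theta> \<partial>circle)"
proof -
  have [measurable]: "h \<in> borel_measurable borel" using assms(1) by (rule borel_measurable_continuous_onI)
  let ?I = "\<lambda>A. \<integral>\<theta>. indicator A \<theta> * h \<theta> \<partial>lborel"
  have int: "integrable lborel (\<lambda>\<theta>. indicator {a..b} \<theta> * h \<theta>)" for a b
    using borel_integrable_atLeastAtMost' [of a b h] continuous_on_subset [OF assms(1)]
    by (simp add: set_integrable_def)
  have "?I {- pi..pi} = (\<integral>\<theta>. indicator {- pi..0} \<theta> * h \<theta> + indicator {0..pi} \<theta> * h \<theta> \<partial>lborel)"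
  proof (rule integral_cong_AE)
    show "AE \<theta> in lborel. indicator {- pi..pi} \<theta> * h \<theta> = indicator {- pi..0} \<theta> * h \<theta> + indicator {0..pi} \<theta> * h \<theta>"
      using AE_lborel_singleton [of "0::real"] by eventually_elim (auto split: split_indicator)
  qed measurable
  also have "\<dots> = ?I {- pi..0} + ?I {0..pi}"
    by (intro Bochner_Integration.integral_add int)
  also have "?I {- pi..0} = (\<integral>\<theta>. indicator {- pi..0} (0 + (-1) * \<theta>) * h (0 + (-1) * \<theta>) \<partial>lborel)"
    by (subst lborel_integral_real_affine [where c = "-1" and t = 0]) simp_all
  also have "\<dots> = ?I {0..pi}"
    by (intro Bochner_Integration.integral_cong refl) (auto simp: assms(2) split: split_indicator)
  finally have "?I {- pi..pi} = 2 * ?I {0..pi}" by simp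
  moreover have "(\<integral>\<theta>. h \<theta> \<partial>half_circle) = 1 / pi * ?I {0..pi}"
  proof -
    have "half_circle = density lborel (\<lambda>\<theta>. ennreal (1 / pi * indicator {0..pi} \<theta>))"
      unfolding half_circle_def by (intro density_cong) (auto split: split_indicator)
    then have "(\<integral>\<theta>. h \<theta> \<partial>half_circle) =
        (\<integral>\<theta>. h \<theta> \<partial>density lborel (\<lambda>\<theta>. ennreal (1 / pi * indicator {0..pi} \<theta>)))"
      by (rule arg_cong)
    also have "\<dots> = (\<integral>\<theta>. (1 / pi * indicator {0..pi} \<theta>) *\<^sub>R h \<theta> \<partial>lborel)"
      by (rule integral_density) auto
    finally show ?thesis by (simp add: mult.assoc)
  qed
  ultimately show ?thesis by (simp add: integral_circle)
qed

text \<open>The sine part of the characteristic function vanishes because the density is even, and the cosine part is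
  transported to the circle by the change of variables.\<close>

lemma char_konno:
  "char konno \<xi> = of_real (1 / (2 * pi)) * of_real (\<integral>\<theta>. cos (\<xi> * group_velocity \<theta>) \<partial>circle)"
proof -
  interpret real_distribution konno by (rule real_distribution_konno)
  have ic: "integrable konno (\<lambda>v. cos (\<xi> * v))" and sin': "integrable konno (\<lambda>v. sin (\<xi> * v))"
    by (auto intro!: integrable_const_bound [where B = 1])
  have "char konno \<xi> = (\<integral>v. of_real (cos (\<xi> * v)) + \<i> * of_real (sin (\<xi> * v)) \<partial>konno)"
    unfolding char_def cis_conv_exp [symmetric]
    by (intro Bochner_Integration.integral_cong refl) (simp add: complex_eq_iff)
  also have "\<dots> = of_real (\<integral>v. cos (\<xi> * v) \<partial>konno) + \<i> * of_real (\<integral>v. sin (\<xi> * v) \<partial>konno)"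
    using ic sin' by (simp add: Bochner_Integration.integral_add)
  also have "(\<integral>v. sin (\<xi> * v) \<partial>konno) = 0"
  proof -
    have "(\<integral>v. sin (\<xi> * v) \<partial>konno) = (\<integral>v. sin (\<xi> * v) * konno_density v \<partial>lborel)"
      by (rule integral_konno) measurable
    also have "\<dots> = - (\<integral>v. sin (\<xi> * v) * konno_density v \<partial>lborel)"
      by (subst lborel_integral_real_affine [where c = "-1" and t = 0])
        (simp_all add: konno_density_minus)
    finally show ?thesis
      using integral_konno [of "\<lambda>v. sin (\<xi> * v)"] by simp
  qed
  also have "(\<integral>v. cos (\<xi> * v) \<partial>konno) = (\<integral>\<theta>. cos (\<xi> * group_velocity \<theta>) \<partial>half_circle)"
    unfolding konno_eq_distr by (subst integral_distr) auto
  also have "\<dots> = 1 / (2 * pi) * (\<integral>\<theta>. cos (\<xi> * group_velocity \<theta>) \<partial>circle)"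
  proof (rule integral_half_circle)
    show "continuous_on UNIV (\<lambda>\<theta>. cos (\<xi> * group_velocity \<theta>))"
      by (intro continuous_intros continuous_group_velocity)
  qed (simp add: group_velocity_def)
  finally show ?thesis by simp
qed

theorem scaled_walk_converges: "weak_conv_m scaled_walk konno"
  by (rule levy_continuity [OF real_distribution_scaled_walk real_distribution_konno])
    (simp only: char_konno char_scaled_walk_tendsto)


lemma integral_scaled_walk_tendsto:
  fixes h :: "real \<Rightarrow> real"
  assumes "continuous_on UNIV h" "\<And>v. \<bar>h v\<bar> \<le> B"
  shows "(\<lambda>m. \<integral>k. h (of_int k / real m) \<partial>measure_pmf (walk_pmf m)) \<longlonglongrightarrow> (\<integral>v. h v * konno_density v \<partial>lborel)"
proof -
  have [measurable]: "h \<in> borel_measurable borel" using assms(1) by (rule borel_measurable_continuous_onI)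
  have "(\<lambda>m. \<integral>v. h v \<partial>scaled_walk m) \<longlonglongrightarrow> (\<integral>v. h v \<partial>konno)"
    by (rule weak_conv_imp_integral_bdd_continuous_conv [OF real_distribution_scaled_walk
        real_distribution_konno scaled_walk_converges, of h B])
      (use assms in \<open>auto simp: continuous_on_eq_continuous_at\<close>)
  then show ?thesis
    by (simp add: scaled_walk_def integral_distr integral_konno)
qed

section \<open>Convergence of the mean occupation numbers\<close>

text \<open>The mean number of walks at site \<open>k\<close> at time \<open>m\<close>, by \<open>site_rate_eq_sum\<close>: a walk seen at \<open>k\<close> after a
  displacement \<open>d\<close> started at \<open>k - d\<close>.\<close>

definition site_rate :: "(real \<Rightarrow> real) \<Rightarrow> nat \<Rightarrow> nat \<Rightarrow> int \<Rightarrow> real" where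
  "site_rate \<gamma> n m k = (\<integral>d. \<gamma> (of_int (k - d) / of_nat n) \<partial>measure_pmf (walk_pmf m))"

text \<open>With \<open>m = nat \<lfloor>t n\<rfloor>\<close> the argument of \<open>\<gamma>\<close> is close to \<open>x - t (d / m)\<close>, uniformly over \<open>\<bar>d\<bar> \<le> m\<close>. As \<open>\<gamma>\<close> is
  uniformly continuous on bounded intervals, the error vanishes, and the law of \<open>d / m\<close> converges.\<close>

lemma site_rate_tendsto:
  fixes \<gamma> :: "real \<Rightarrow> real" and x t :: real and j :: int
  assumes cont: "continuous_on UNIV \<gamma>" and supp: "compact (closure {y. \<gamma> y \<noteq> 0})" and t: "t > 0"
  shows "(\<lambda>n. site_rate \<gamma> n (nat \<lfloor>t * real n\<rfloor>) (j + \<lfloor>x * real n\<rfloor>)) \<longlonglongrightarrow> limit_profile \<gamma> t x"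
proof -
  define m where "m = (\<lambda>n. nat \<lfloor>t * real n\<rfloor>)"
  define u where "u = (\<lambda>n. of_int (j + \<lfloor>x * real n\<rfloor>) / real n)"
  have m_top: "filterlim m at_top sequentially"
    unfolding m_def using t by real_asymp
  have u_lim: "u \<longlonglongrightarrow> x"
    unfolding u_def by real_asymp
  have m_lim: "(\<lambda>n. real (m n) / real n) \<longlonglongrightarrow> t"
    unfolding m_def using t by real_asymp
  have unif: "uniformly_continuous_on {x - t - 1..x + t + 1} \<gamma>"
    by (intro compact_uniformly_continuous continuous_on_subset [OF cont]) auto
  obtain B where B: "\<And>y. \<bar>\<gamma> y\<bar> \<le> B"
  proof -
    have "bounded (\<gamma> ` closure {y. \<gamma> y \<noteq> 0})"
      by (intro compact_imp_bounded compact_continuous_image continuous_on_subset [OF cont] supp) auto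
    then obtain C where "\<And>y. y \<in> closure {y. \<gamma> y \<noteq> 0} \<Longrightarrow> \<bar>\<gamma> y\<bar> \<le> C"
      by (auto simp: bounded_iff)
    then have "\<And>y. \<bar>\<gamma> y\<bar> \<le> max C 0"
      using closure_subset [of "{y. \<gamma> y \<noteq> 0}"] by (auto simp: le_max_iff_disj)
    then show ?thesis by (rule that)
  qed
  have main: "(\<lambda>n. \<integral>k. \<gamma> (x - t * (of_int k / real (m n))) \<partial>measure_pmf (walk_pmf (m n)))
      \<longlonglongrightarrow> (\<integral>v. \<gamma> (x - t * v) * konno_density v \<partial>lborel)"
  proof (rule filterlim_compose [OF integral_scaled_walk_tendsto m_top])
    show "continuous_on UNIV (\<lambda>v. \<gamma> (x - t * v))"
      by (intro continuous_on_compose2 [OF cont] continuous_intros) auto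
  qed (rule B)
  have diff: "(\<lambda>n. (\<integral>k. \<gamma> (u n - of_int k / real n) \<partial>measure_pmf (walk_pmf (m n))) -
      (\<integral>k. \<gamma> (x - t * (of_int k / real (m n))) \<partial>measure_pmf (walk_pmf (m n)))) \<longlonglongrightarrow> 0"
  proof (rule LIMSEQ_I)
    fix e :: real assume "e > 0"
    show "\<exists>no. \<forall>n\<ge>no. norm ((\<integral>k. \<gamma> (u n - of_int k / real n) \<partial>measure_pmf (walk_pmf (m n))) -
      (\<integral>k. \<gamma> (x - t * (of_int k / real (m n))) \<partial>measure_pmf (walk_pmf (m n))) - 0) < e"
    proof -
      obtain d where d: "d > 0" "\<And>y z. y \<in> {x - t - 1..x + t + 1} \<Longrightarrow> z \<in> {x - t - 1..x + t + 1} \<Longrightarrow>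
          \<bar>z - y\<bar> < d \<Longrightarrow> \<bar>\<gamma> z - \<gamma> y\<bar> < e / 2"
        using unif \<open>e > 0\<close> unfolding uniformly_continuous_on_def dist_real_def
        by (meson half_gt_zero)
      have "(\<lambda>n. \<bar>u n - x\<bar> + \<bar>real (m n) / real n - t\<bar>) \<longlonglongrightarrow> \<bar>x - x\<bar> + \<bar>t - t\<bar>"
        by (intro tendsto_intros u_lim m_lim)
      then have "\<forall>\<^sub>F n in sequentially. \<bar>u n - x\<bar> + \<bar>real (m n) / real n - t\<bar> < min d 1"
        by (rule order_tendstoD) (use d in simp)
      moreover have "\<forall>\<^sub>F n in sequentially. 0 < m n"
        by (rule eventually_compose_filterlim [OF eventually_gt_at_top m_top])
      ultimately have "\<forall>\<^sub>F n in sequentially. norm ((\<integral>k. \<gamma> (u n - of_int k / real n) \<partial>measure_pmf (walk_pmf (m n))) -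
          (\<integral>k. \<gamma> (x - t * (of_int k / real (m n))) \<partial>measure_pmf (walk_pmf (m n))) - 0) < e"
      proof eventually_elim
        case (elim n)
        have n: "0 < real n" using elim(2) by (cases "n = 0") (auto simp: m_def)
        let ?p = "measure_pmf (walk_pmf (m n))"
        let ?f = "\<lambda>k. \<gamma> (u n - of_int k / real n)" and ?g = "\<lambda>k. \<gamma> (x - t * (of_int k / real (m n)))"
        have int: "integrable ?p ?f" "integrable ?p ?g"
          by (auto intro!: measure_pmf.integrable_const_bound [where B = B] B)
        have "\<bar>?f k - ?g k\<bar> \<le> e / 2" if k: "k \<in> set_pmf (walk_pmf (m n))" for k
        proof -
          define q where "q = of_int k / real (m n)"
          have "k \<in> {- int (m n)..int (m n)}" using set_walk_pmf k by blast
          then have "\<bar>k\<bar> \<le> int (m n)" unfolding atLeastAtMost_iff by linarith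
          then have "\<bar>real_of_int k\<bar> \<le> real (m n)" by linarith
          then have q: "\<bar>q\<bar> \<le> 1" using elim(2) by (simp add: q_def abs_divide)
          \<comment> \<open>The displacement relative to \<open>n\<close> is its value relative to \<open>m n\<close>, at most \<open>1\<close>, times a factor close to \<open>t\<close>.\<close>
          have kn: "of_int k / real n = q * (real (m n) / real n)"
            using elim(2) by (simp add: q_def)
          have "\<bar>(u n - of_int k / real n) - (x - t * q)\<bar> = \<bar>(u n - x) - q * (real (m n) / real n - t)\<bar>"
            unfolding kn by (simp add: algebra_simps)
          also have "\<dots> \<le> \<bar>u n - x\<bar> + \<bar>q\<bar> * \<bar>real (m n) / real n - t\<bar>"
            by (metis abs_mult abs_triangle_ineq4)
          also have "\<dots> \<le> \<bar>u n - x\<bar> + 1 * \<bar>real (m n) / real n - t\<bar>"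
            by (intro add_left_mono mult_right_mono q) auto
          also have "\<dots> < min d 1"
            using elim(1) by (simp only: mult_1)
          finally have close: "\<bar>(u n - of_int k / real n) - (x - t * q)\<bar> < min d 1" .
          then have close1: "\<bar>(u n - of_int k / real n) - (x - t * q)\<bar> < 1" by simp
          have "\<bar>t * q\<bar> \<le> t * 1"
            unfolding abs_mult using t q by (intro mult_mono) auto
          then have 1: "x - t * q \<in> {x - t - 1..x + t + 1}" and 2: "u n - of_int k / real n \<in> {x - t - 1..x + t + 1}"
            using close1 unfolding atLeastAtMost_iff by linarith+
          from close have "\<bar>(u n - of_int k / real n) - (x - t * q)\<bar> < d" by simp
          from d(2) [OF 1 2 this] show ?thesis by (simp add: q_def)
        qed
        then have "AE k in ?p. norm (?f k - ?g k) \<le> e / 2"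
          by (intro AE_pmfI) simp
        then have "(\<integral>k. norm (?f k - ?g k) \<partial>?p) \<le> (\<integral>k. e / 2 \<partial>?p)"
          using int by (intro integral_mono_AE) auto
        then have "(\<integral>k. norm (?f k - ?g k) \<partial>?p) \<le> e / 2" by simp
        moreover have "norm ((\<integral>k. ?f k \<partial>?p) - (\<integral>k. ?g k \<partial>?p)) \<le> (\<integral>k. norm (?f k - ?g k) \<partial>?p)"
          unfolding Bochner_Integration.integral_diff [OF int, symmetric] by (rule integral_norm_bound)
        ultimately show ?case
          unfolding diff_zero using \<open>e > 0\<close> by linarith
      qed
      then show ?thesis by (simp add: eventually_sequentially)
    qed
  qed
  have "(\<integral>v. \<gamma> (x - t * v) * konno_density v \<partial>lborel) = limit_profile \<gamma> t x"
  proof -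
    have "limit_profile \<gamma> t x =
        t * (\<integral>v. \<gamma> (x + - t * v) * (1 / t * konno_density ((x - (x + - t * v)) / t)) \<partial>lborel)"
      unfolding limit_profile_def
      by (subst lborel_integral_real_affine [where c = "- t" and t = x]) (use t in simp_all)
    also have "\<dots> = t * (\<integral>v. 1 / t * (\<gamma> (x - t * v) * konno_density v) \<partial>lborel)"
      using t by (simp add: mult.left_commute)
    finally show ?thesis
      unfolding Bochner_Integration.integral_mult_right_zero using t by simp
  qed
  then show ?thesis
    using tendsto_add [OF diff main] unfolding u_def m_def
    by (simp add: site_rate_def diff_divide_distrib)
qed

section \<open>Poisson systems of independent walks\<close>

text \<open>The index set may be uncountable, as it is for the product over all states; only finitely many
  coordinates enter, and their joint law is the finite product.\<close>

lemma (in product_prob_space) integral_prod_coordinates: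
  fixes f :: "'i \<Rightarrow> 'a \<Rightarrow> real"
  assumes J: "finite J" "J \<subseteq> I" and f: "\<And>i. i \<in> J \<Longrightarrow> integrable (M i) (f i)"
  shows "(\<integral>x. (\<Prod>i\<in>J. f i (x i)) \<partial>PiM I M) = (\<Prod>i\<in>J. integral\<^sup>L (M i) (f i))"
proof -
  have "(\<Prod>i\<in>J. integral\<^sup>L (M i) (f i)) = (\<integral>x. (\<Prod>i\<in>J. f i (x i)) \<partial>PiM J M)"
    by (rule product_integral_prod [OF J(1) f, symmetric])
  also have "\<dots> = (\<integral>x. (\<Prod>i\<in>J. f i (x i)) \<partial>distr (PiM I M) (PiM J M) (\<lambda>x. restrict x J))"
    by (simp only: distr_PiM_restrict_finite [OF J])
  also have "\<dots> = (\<integral>x. (\<Prod>i\<in>J. f i (restrict x J i)) \<partial>PiM I M)"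
  proof (rule integral_distr)
    show "(\<lambda>x. restrict x J) \<in> Pi\<^sub>M I M \<rightarrow>\<^sub>M Pi\<^sub>M J M" by (rule measurable_restrict_subset [OF J(2)])
    show "(\<lambda>x. \<Prod>i\<in>J. f i (x i)) \<in> borel_measurable (Pi\<^sub>M J M)"
      using f by (intro borel_measurable_prod measurable_compose [OF measurable_component_singleton])
        (auto dest: borel_measurable_integrable)
  qed
  also have "\<dots> = (\<integral>x. (\<Prod>i\<in>J. f i (x i)) \<partial>PiM I M)" by simp
  finally show ?thesis by simp
qed

lemma poisson_pgf_sums:
  fixes \<alpha> z :: real
  assumes "0 \<le> \<alpha>"
  shows "(\<lambda>n. pmf (poisson \<alpha>) n * z ^ n) sums exp (\<alpha> * (z - 1))"
proof -
  have "(\<lambda>n. exp (- \<alpha>) * ((\<alpha> * z) ^ n /\<^sub>R fact n)) sums (exp (- \<alpha>) * exp (\<alpha> * z))"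
    by (intro sums_mult exp_converges)
  then show ?thesis
    using assms by (simp add: pmf_poisson_nonneg power_mult_distrib divide_inverse exp_add [symmetric] algebra_simps)
qed

lemma integral_pmf_nat_sums:
  fixes f :: "nat \<Rightarrow> real"
  assumes "\<And>n. \<bar>f n\<bar> \<le> B" 
  shows "(\<lambda>n. pmf p n * f n) sums (\<integral>n. f n \<partial>measure_pmf p)"
proof -
  have "integrable (measure_pmf p) f"
    using assms by (intro measure_pmf.integrable_const_bound [where B = B]) auto
  then have "integrable (count_space UNIV) (\<lambda>n. pmf p n *\<^sub>R f n)"
    unfolding measure_pmf_eq_density by (subst (asm) integrable_density) auto
  then have "(\<lambda>n. pmf p n *\<^sub>R f n) sums (\<integral>n. pmf p n *\<^sub>R f n \<partial>count_space UNIV)"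
    by (rule sums_integral_count_space_nat)
  also have "(\<integral>n. pmf p n *\<^sub>R f n \<partial>count_space UNIV) = (\<integral>n. f n \<partial>measure_pmf p)"
    unfolding measure_pmf_eq_density by (subst integral_density) auto
  finally show ?thesis by simp
qed

lemma integral_poisson_pgf:
  fixes \<alpha> z :: real
  assumes "0 \<le> \<alpha>" "\<bar>z\<bar> \<le> 1"
  shows "(\<integral>n. z ^ n \<partial>measure_pmf (poisson \<alpha>)) = exp (\<alpha> * (z - 1))"
  by (rule sums_unique2 [OF integral_pmf_nat_sums [where B = 1] poisson_pgf_sums [OF assms(1)]])
    (use assms in \<open>simp add: power_abs power_le_one\<close>)

lemma integral_restrict_pmf:
  "(\<integral>n. f n \<partial>restrict_space (measure_pmf p) (set_pmf p)) = (\<integral>n. f n \<partial>measure_pmf p)"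
  for f :: "_ \<Rightarrow> real"
  by (subst integral_restrict_space) (auto intro!: integral_cong_AE AE_pmfI)

text \<open>Superposition adds the rates of the walks coming from different states. A state contributes only if its
  rate is positive and its distance from \<open>k\<close> is at most \<open>m\<close>, so the sum may run over all states within distance \<open>m\<close>.
  The factor \<open>1 / 2\<close> in the initial rates becomes the fair mixture of the two coin states.\<close>

lemma site_rate_eq_sum:
  assumes "compact (closure {y. \<gamma> y \<noteq> 0})" and "n > 0"
  shows "(\<Sum>\<psi> | initial_rate \<gamma> n \<psi> \<noteq> 0. initial_rate \<gamma> n \<psi> * pmf (position_pmf m \<psi>) k) = site_rate \<gamma> n m k"
proof -
  let ?K = "{- int m..int m}"
  let ?T = "(\<lambda>(d, r). ket (k - d) \<otimes>\<^sub>h ket r) ` (?K \<times> UNIV)"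
  let ?g = "\<lambda>\<psi>. initial_rate \<gamma> n \<psi> * pmf (position_pmf m \<psi>) k"
  have inj: "inj_on (\<lambda>(d, r). ket (k - d) \<otimes>\<^sub>h ket r) (?K \<times> UNIV)"
    by (auto simp: inj_on_def tensor_ket ket_eq_iff)
  have "sum ?g {\<psi>. initial_rate \<gamma> n \<psi> \<noteq> 0} = sum ?g ?T"
  proof (rule sum.mono_neutral_cong)
    show "finite {\<psi>. initial_rate \<gamma> n \<psi> \<noteq> 0}" using assms by (rule finite_support_initial_rate)
    fix \<psi> assume \<psi>: "\<psi> \<in> {\<psi>. initial_rate \<gamma> n \<psi> \<noteq> 0} - ?T"
    then obtain j r where jr: "\<psi> = ket j \<otimes>\<^sub>h ket r" by (auto simp: initial_rate_def split: if_splits)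
    have "k - j \<notin> ?K"
    proof
      assume "k - j \<in> ?K"
      then have "\<psi> \<in> ?T" unfolding jr by (intro image_eqI [of _ _ "(k - j, r)"]) auto
      with \<psi> show False by blast
    qed
    then show "?g \<psi> = 0" by (auto simp: jr pmf_position_ket amplitude_eq_0)
  qed auto
  also have "\<dots> = (\<Sum>(d, r)\<in>?K \<times> UNIV. ?g (ket (k - d) \<otimes>\<^sub>h ket r))"
    by (subst sum.reindex [OF inj]) (simp add: case_prod_unfold)
  also have "\<dots> = (\<Sum>d\<in>?K. \<Sum>r\<in>UNIV. ?g (ket (k - d) \<otimes>\<^sub>h ket r))"
    by (rule sum.cartesian_product [symmetric])
  also have "\<dots> = (\<Sum>d\<in>?K. pmf (walk_pmf m) d *\<^sub>R \<gamma> (of_int (k - d) / of_nat n))"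
    by (intro sum.cong refl) (simp add: initial_rate_ket pmf_position_ket pmf_walk sum_coin field_simps)
  also have "\<dots> = site_rate \<gamma> n m k"
    unfolding site_rate_def by (rule integral_measure_pmf [symmetric]) (use set_walk_pmf [of m] in auto)
  finally show ?thesis .
qed

lemma initial_rate_nonneg: "(\<And>y. 0 \<le> \<gamma> y) \<Longrightarrow> 0 \<le> initial_rate \<gamma> n \<psi>"
  by (simp add: initial_rate_def)

text \<open>A walk at position \<open>y\<close> contributes one factor \<open>z y\<close> if \<open>y \<in> F\<close> and no factor otherwise, so the generating
  function of the occupation numbers is a product over walks instead of sites.\<close>

lemma occupation_pgf_aux:
  fixes z :: "int \<Rightarrow> real"
  assumes "finite F" "finite S" "{\<psi>. \<Psi> \<psi> \<noteq> 0} \<subseteq> S"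
  shows "(\<Prod>k\<in>F. z k ^ occupation_at \<Psi> X k) =
    (\<Prod>p\<in>(SIGMA \<psi>:S. {1..\<Psi> \<psi>}). if X p \<in> F then z (X p) else 1)"
proof -
  have "occupation_at \<Psi> X k = (\<Sum>p\<in>(SIGMA \<psi>:S. {1..\<Psi> \<psi>}). of_bool (X p = k))" for k
  proof -
    have "occupation_at \<Psi> X k = (\<Sum>\<psi>\<in>S. \<Sum>j = 1..\<Psi> \<psi>. of_bool (X (\<psi>, j) = k))"
      unfolding occupation_at_def using assms by (intro sum.mono_neutral_left) auto
    also have "\<dots> = (\<Sum>(\<psi>, j)\<in>(SIGMA \<psi>:S. {1..\<Psi> \<psi>}). of_bool (X (\<psi>, j) = k))"
      using assms(2) by (intro sum.Sigma) auto
    finally show ?thesis by (simp only: case_prod_unfold prod.collapse)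
  qed
  then have "(\<Prod>k\<in>F. z k ^ occupation_at \<Psi> X k) =
      (\<Prod>k\<in>F. \<Prod>p\<in>(SIGMA \<psi>:S. {1..\<Psi> \<psi>}). z k ^ of_bool (X p = k))"
    by (simp add: power_sum)
  also have "\<dots> = (\<Prod>p\<in>(SIGMA \<psi>:S. {1..\<Psi> \<psi>}). \<Prod>k\<in>F. z k ^ of_bool (X p = k))"
    by (rule prod.swap)
  also have "\<dots> = (\<Prod>p\<in>(SIGMA \<psi>:S. {1..\<Psi> \<psi>}). if X p \<in> F then z (X p) else 1)"
  proof (rule prod.cong [OF refl])
    fix p
    have "(\<Prod>k\<in>F. z k ^ of_bool (X p = k)) = (\<Prod>k\<in>F. if k = X p then z k else 1)"
      by (intro prod.cong refl) auto
    then show "(\<Prod>k\<in>F. z k ^ of_bool (X p = k)) = (if X p \<in> F then z (X p) else 1)"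
      using assms(1) by simp
  qed
  finally show ?thesis .
qed

text \<open>Given the configuration, the walks are independent, so averaging over the positions yields
  \<open>\<Prod>\<psi>. a \<psi> ^ \<Psi> \<psi>\<close> with \<open>a \<psi>\<close> the mean contribution of one walk. Averaging over the Poisson variables \<open>\<Psi> \<psi>\<close>
  turns this into the exponential of a sum that is linear in the contributions at the sites of \<open>F\<close>, hence into a product over
  sites.\<close>

lemma integral_occupation_pgf:
  fixes z :: "int \<Rightarrow> real"
  assumes \<gamma>: "\<And>y. 0 \<le> \<gamma> y" "compact (closure {y. \<gamma> y \<noteq> 0})" and n: "n > 0"
    and F: "finite F" and z: "\<And>k. \<bar>z k\<bar> \<le> 1"
  shows "(\<integral>\<eta>. (\<Prod>k\<in>F. z k ^ \<eta> k) \<partial>occupation_law \<gamma> n m) = (\<Prod>k\<in>F. exp (site_rate \<gamma> n m k * (z k - 1)))"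
proof -
  let ?I = "initial_measure \<gamma> n" and ?P = "positions m"
  let ?S = "{\<psi>. initial_rate \<gamma> n \<psi> \<noteq> 0}"
  let ?R = "\<lambda>\<psi>. restrict_space (measure_pmf (poisson (initial_rate \<gamma> n \<psi>))) (set_pmf (poisson (initial_rate \<gamma> n \<psi>)))"
  define f where "f = (\<lambda>y. if y \<in> F then z y else 1)"
  define a where "a = (\<lambda>\<psi>. \<integral>y. f y \<partial>measure_pmf (position_pmf m \<psi>))"
  have S: "finite ?S" using \<gamma>(2) n by (rule finite_support_initial_rate)
  have f1: "\<bar>f y\<bar> \<le> 1" for y using z by (simp add: f_def)
  have f_int: "integrable (measure_pmf p) f" for p
    by (rule measure_pmf.integrable_const_bound [where B = 1]) (use f1 in auto)
  interpret pair_prob_space ?I ?P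
    by (intro pair_prob_space.intro pair_sigma_finite.intro prob_space_initial_measure
        prob_space_positions prob_space_imp_sigma_finite)
  interpret P: product_prob_space "\<lambda>p :: state \<times> nat. measure_pmf (position_pmf m (fst p))" UNIV
    by standard
  interpret R: product_prob_space ?R UNIV
    by (intro product_prob_spaceI prob_space_restrict_pmf)
  have P_eq: "?P = PiM UNIV (\<lambda>p :: state \<times> nat. measure_pmf (position_pmf m (fst p)))"
    by (simp add: positions_def case_prod_unfold)
  have meas: "(\<lambda>\<eta>. \<Prod>k\<in>F. z k ^ \<eta> k) \<in> borel_measurable occupation_space"
    unfolding occupation_space_def by measurable
  note occ = measurable_occupation_at [OF \<gamma>(2) n, of m]
  have bound: "\<bar>\<Prod>k\<in>F. z k ^ \<eta> k\<bar> \<le> 1" for \<eta> :: occupation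
    unfolding abs_prod by (intro prod_le_1) (auto simp: power_abs z power_le_one)
  have "(\<integral>\<eta>. (\<Prod>k\<in>F. z k ^ \<eta> k) \<partial>occupation_law \<gamma> n m) =
      (\<integral>\<omega>. (\<Prod>k\<in>F. z k ^ (case \<omega> of (\<Psi>, X) \<Rightarrow> occupation_at \<Psi> X) k) \<partial>(?I \<Otimes>\<^sub>M ?P))"
    unfolding occupation_law_def by (rule integral_distr [OF occ meas])
  also have "\<dots> = (\<integral>\<Psi>. \<integral>X. (\<Prod>k\<in>F. z k ^ occupation_at \<Psi> X k) \<partial>?P \<partial>?I)"
  proof (subst integral_fst' [symmetric])
    show "integrable (?I \<Otimes>\<^sub>M ?P) (\<lambda>\<omega>. \<Prod>k\<in>F. z k ^ (case \<omega> of (\<Psi>, X) \<Rightarrow> occupation_at \<Psi> X) k)"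
      using measurable_compose [OF occ meas] bound by (intro integrable_const_bound [where B = 1]) auto
  qed simp
  also have "\<dots> = (\<integral>\<Psi>. (\<Prod>\<psi>\<in>?S. a \<psi> ^ \<Psi> \<psi>) \<partial>?I)"
  proof (rule Bochner_Integration.integral_cong [OF refl])
    fix \<Psi> assume "\<Psi> \<in> space ?I"
    then have supp: "{\<psi>. \<Psi> \<psi> \<noteq> 0} \<subseteq> ?S" by (rule configuration_support)
    have "(\<integral>X. (\<Prod>k\<in>F. z k ^ occupation_at \<Psi> X k) \<partial>?P) = (\<integral>X. (\<Prod>p\<in>(SIGMA \<psi>:?S. {1..\<Psi> \<psi>}). f (X p)) \<partial>?P)"
      by (simp only: occupation_pgf_aux [OF F S supp] f_def)
    also have "\<dots> = (\<Prod>p\<in>(SIGMA \<psi>:?S. {1..\<Psi> \<psi>}). a (fst p))"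
      unfolding P_eq a_def by (rule P.integral_prod_coordinates) (use S f_int in auto)
    also have "\<dots> = (\<Prod>\<psi>\<in>?S. \<Prod>j\<in>{1..\<Psi> \<psi>}. a \<psi>)"
      using S by (subst prod.Sigma) (auto simp: case_prod_unfold)
    finally show "(\<integral>X. (\<Prod>k\<in>F. z k ^ occupation_at \<Psi> X k) \<partial>?P) = (\<Prod>\<psi>\<in>?S. a \<psi> ^ \<Psi> \<psi>)" by simp
  qed
  also have "\<dots> = (\<Prod>\<psi>\<in>?S. exp (initial_rate \<gamma> n \<psi> * (a \<psi> - 1)))"
  proof -
    have a1: "\<bar>a \<psi>\<bar> \<le> 1" for \<psi>
    proof -
      have "\<bar>a \<psi>\<bar> \<le> (\<integral>y. \<bar>f y\<bar> \<partial>measure_pmf (position_pmf m \<psi>))"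
        unfolding a_def by (rule integral_abs_bound)
      also have "\<dots> \<le> (\<integral>y. 1 \<partial>measure_pmf (position_pmf m \<psi>))"
        by (intro integral_mono integrable_abs f_int f1) auto
      finally show ?thesis by simp
    qed
    have "(\<integral>\<Psi>. (\<Prod>\<psi>\<in>?S. a \<psi> ^ \<Psi> \<psi>) \<partial>?I) = (\<Prod>\<psi>\<in>?S. \<integral>N. a \<psi> ^ N \<partial>?R \<psi>)"
      unfolding initial_measure_def
    proof (rule R.integral_prod_coordinates [OF S])
      fix \<psi>
      show "integrable (?R \<psi>) (\<lambda>N. a \<psi> ^ N)"
        by (rule R.M.integrable_const_bound [where B = 1])
          (auto simp: power_abs a1 power_le_one intro!: measurable_restrict_space1)
    qed auto
    also have "\<dots> = (\<Prod>\<psi>\<in>?S. exp (initial_rate \<gamma> n \<psi> * (a \<psi> - 1)))"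
      unfolding integral_restrict_pmf
      by (intro prod.cong refl integral_poisson_pgf initial_rate_nonneg \<gamma>(1) a1)
    finally show ?thesis .
  qed
  also have "\<dots> = exp (\<Sum>\<psi>\<in>?S. initial_rate \<gamma> n \<psi> * (a \<psi> - 1))"
    using S by (rule exp_sum [symmetric])
  also have "(\<Sum>\<psi>\<in>?S. initial_rate \<gamma> n \<psi> * (a \<psi> - 1)) = (\<Sum>k\<in>F. site_rate \<gamma> n m k * (z k - 1))"
  proof -
    have a_eq: "a \<psi> - 1 = (\<Sum>k\<in>F. pmf (position_pmf m \<psi>) k * (z k - 1))" for \<psi>
    proof -
      have "a \<psi> - 1 = (\<integral>y. f y - 1 \<partial>measure_pmf (position_pmf m \<psi>))"
        unfolding a_def by (subst Bochner_Integration.integral_diff [OF f_int]) auto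
      also have "\<dots> = (\<Sum>k\<in>F. pmf (position_pmf m \<psi>) k *\<^sub>R (f k - 1))"
        by (rule integral_measure_pmf [OF F]) (auto simp: f_def split: if_splits)
      finally show ?thesis by (simp add: f_def)
    qed
    have "(\<Sum>\<psi>\<in>?S. initial_rate \<gamma> n \<psi> * (a \<psi> - 1)) =
        (\<Sum>k\<in>F. \<Sum>\<psi>\<in>?S. initial_rate \<gamma> n \<psi> * pmf (position_pmf m \<psi>) k * (z k - 1))"
      by (subst sum.swap) (simp add: a_eq sum_distrib_left mult.assoc)
    also have "\<dots> = (\<Sum>k\<in>F. site_rate \<gamma> n m k * (z k - 1))"
      by (simp add: sum_distrib_right [symmetric] site_rate_eq_sum [OF \<gamma>(2) n])
    finally show ?thesis .
  qed
  also have "exp \<dots> = (\<Prod>k\<in>F. exp (site_rate \<gamma> n m k * (z k - 1)))"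
    using F by (rule exp_sum)
  finally show ?thesis .
qed

section \<open>Generating functions determine joint laws\<close>

lemma powser_coefficients_unique:
  fixes a b :: "nat \<Rightarrow> real"
  assumes a: "\<And>w. \<bar>w\<bar> < 1 \<Longrightarrow> (\<lambda>n. a n * w ^ n) sums f w"
    and b: "\<And>w. \<bar>w\<bar> < 1 \<Longrightarrow> (\<lambda>n. b n * w ^ n) sums f w"
  shows "a n = b n"
proof (induction n rule: less_induct)
  case (less n)
  have "(\<lambda>k. (a (k + n) - b (k + n)) * w ^ k) sums 0" if w: "w \<noteq> 0" "norm w < 1" for w
  proof -
    have "(\<lambda>k. a k * w ^ k - b k * w ^ k) sums (f w - f w)"
      using w by (intro sums_diff a b) simp_all
    then have "(\<lambda>k. a (k + n) * w ^ (k + n) - b (k + n) * w ^ (k + n)) sums (f w - f w - (\<Sum>i<n. a i * w ^ i - b i * w ^ i))"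
      by (rule sums_split_initial_segment)
    then have "(\<lambda>k. (a (k + n) - b (k + n)) * w ^ k * w ^ n) sums 0"
      using less.IH by (simp add: power_add algebra_simps)
    then show ?thesis
      using w by (simp add: sums_mult2_iff [of "w ^ n" _ 0, simplified])
  qed
  \<comment> \<open>The power series with the first \<open>n\<close> coefficients removed vanishes away from \<open>0\<close>, hence also its
    constant term.\<close>
  then have "((\<lambda>_. 0) \<longlongrightarrow> a (0 + n) - b (0 + n)) (at (0::real))"
    by (intro powser_limit_0_strong [where s = 1 and a = "\<lambda>k. a (k + n) - b (k + n)"]) auto
  then have "a (0 + n) - b (0 + n) = 0"
    by (rule LIM_unique [OF _ tendsto_const])
  then show ?case by simp
qed

text \<open>The weight \<open>W\<close> carries the information on the other coordinates when this one-dimensional statement is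
  applied to one coordinate of a random vector.\<close>

lemma (in prob_space) weighted_pgf_determines_masses:
  fixes N :: "'a \<Rightarrow> nat" and W :: "'a \<Rightarrow> real"
  assumes N: "N \<in> M \<rightarrow>\<^sub>M count_space UNIV" and W: "W \<in> borel_measurable M" "\<And>\<omega>. \<bar>W \<omega>\<bar> \<le> 1"
    and sums: "\<And>w. \<bar>w\<bar> < 1 \<Longrightarrow> (\<lambda>l. p l * w ^ l) sums (\<integral>\<omega>. W \<omega> * w ^ N \<omega> \<partial>M)"
  shows "(\<integral>\<omega>. W \<omega> * of_bool (N \<omega> = l) \<partial>M) = p l"
proof (rule powser_coefficients_unique [OF _ sums])
  fix w :: real assume w: "\<bar>w\<bar> < 1"
  note [measurable] = N W(1)
  let ?f = "\<lambda>l \<omega>. W \<omega> * of_bool (N \<omega> = l) * w ^ l"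
  have fin: "?f l \<omega> = 0" if "l \<notin> {N \<omega>}" for l \<omega> using that by simp
  have fb: "\<bar>?f l \<omega>\<bar> \<le> \<bar>w\<bar> ^ l" for l \<omega>
    using mult_right_mono [OF W(2) [of \<omega>], of "\<bar>w\<bar> ^ l"] by (simp add: abs_mult power_abs)
  have int: "integrable M (?f l)" for l
    by (rule integrable_const_bound [where B = "\<bar>w\<bar> ^ l"]) (use fb in auto)
  have "(\<lambda>l. \<integral>\<omega>. ?f l \<omega> \<partial>M) sums (\<integral>\<omega>. (\<Sum>l. ?f l \<omega>) \<partial>M)"
  proof (rule sums_integral [OF int])
    show "AE \<omega> in M. summable (\<lambda>l. norm (?f l \<omega>))"
      by (intro AE_I2 summable_finite [where N = "{N \<omega>}" for \<omega>]) auto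
    show "summable (\<lambda>l. \<integral>\<omega>. norm (?f l \<omega>) \<partial>M)"
    proof (rule summable_comparison_test' [OF summable_geometric [of "\<bar>w\<bar>"]])
      fix l
      have "(\<integral>\<omega>. norm (?f l \<omega>) \<partial>M) \<le> (\<integral>\<omega>. \<bar>w\<bar> ^ l \<partial>M)"
        by (intro integral_mono integrable_norm int) (use fb in auto)
      then show "norm (\<integral>\<omega>. norm (?f l \<omega>) \<partial>M) \<le> \<bar>w\<bar> ^ l"
        by (simp add: prob_space)
    qed (use w in simp)
  qed
  moreover have "(\<Sum>l. ?f l \<omega>) = W \<omega> * w ^ N \<omega>" for \<omega>
    using suminf_finite [of "{N \<omega>}" "\<lambda>l. ?f l \<omega>"] by simp
  ultimately show "(\<lambda>l. (\<integral>\<omega>. W \<omega> * of_bool (N \<omega> = l) \<partial>M) * w ^ l) sums (\<integral>\<omega>. W \<omega> * w ^ N \<omega> \<partial>M)"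
    by simp
qed

text \<open>Coordinates are exchanged one at a time: for the coordinates in a growing set \<open>A\<close> the power \<open>z k ^ N k\<close> is replaced by
  the indicator of \<open>N k = l k\<close>, comparing coefficients of a power series in the single variable \<open>z a\<close>.\<close>

lemma (in prob_space) joint_pgf_determines_masses:
  fixes N :: "'i \<Rightarrow> 'a \<Rightarrow> nat" and \<kappa> :: "'i \<Rightarrow> real \<Rightarrow> real" and q :: "'i \<Rightarrow> nat \<Rightarrow> real"
  assumes F: "finite F" and N: "\<And>k. k \<in> F \<Longrightarrow> N k \<in> M \<rightarrow>\<^sub>M count_space UNIV"
    and q: "\<And>k w. k \<in> F \<Longrightarrow> \<bar>w\<bar> < 1 \<Longrightarrow> (\<lambda>l. q k l * w ^ l) sums \<kappa> k w"
    and pgf: "\<And>z. (\<And>k. \<bar>z k\<bar> < 1) \<Longrightarrow> (\<integral>\<omega>. (\<Prod>k\<in>F. z k ^ N k \<omega>) \<partial>M) = (\<Prod>k\<in>F. \<kappa> k (z k))"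
  shows "prob {\<omega>\<in>space M. \<forall>k\<in>F. N k \<omega> = l k} = (\<Prod>k\<in>F. q k (l k))"
proof -
  have part: "(\<integral>\<omega>. (\<Prod>k\<in>A. of_bool (N k \<omega> = l k)) * (\<Prod>k\<in>F - A. z k ^ N k \<omega>) \<partial>M) =
      (\<Prod>k\<in>A. q k (l k)) * (\<Prod>k\<in>F - A. \<kappa> k (z k))" if z: "\<And>k. \<bar>z k\<bar> < 1" and "A \<subseteq> F" for A z
    using finite_subset [OF that(2) F] that
  proof (induction A arbitrary: z rule: finite_induct)
    case empty
    then show ?case using pgf [of z] by simp
  next
    case (insert a A)
    have aF: "a \<in> F" and A: "A \<subseteq> F" "finite A" using insert by auto
    have split: "F - A = insert a (F - insert a A)" "a \<notin> F - insert a A" using insert by auto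
    have finD: "finite (F - insert a A)" using F by simp
    let ?W = "\<lambda>\<omega>. (\<Prod>k\<in>A. of_bool (N k \<omega> = l k)) * (\<Prod>k\<in>F - insert a A. z k ^ N k \<omega>) :: real"
    let ?c = "(\<Prod>k\<in>A. q k (l k)) * (\<Prod>k\<in>F - insert a A. \<kappa> k (z k))"
    have "(\<integral>\<omega>. ?W \<omega> * of_bool (N a \<omega> = l a) \<partial>M) = ?c * q a (l a)"
    proof (rule weighted_pgf_determines_masses [OF N [OF aF]])
      have [measurable]: "N k \<in> M \<rightarrow>\<^sub>M count_space UNIV" if "k \<in> F" for k using N that .
      show "?W \<in> borel_measurable M"
        using A insert(4) by (intro borel_measurable_times borel_measurable_prod) (auto intro!: measurable_compose [OF N])
      show "\<bar>?W \<omega>\<bar> \<le> 1" for \<omega>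
      proof -
        have "\<bar>z k\<bar> ^ N k \<omega> \<le> 1" for k
          using insert.prems(1) [of k] by (simp add: power_le_one)
        then have "\<bar>?W \<omega>\<bar> \<le> 1 * 1"
          unfolding abs_mult abs_prod
          by (intro mult_mono prod_le_1 prod_nonneg)
            (auto simp: power_abs)
        then show ?thesis by simp
      qed
      fix w :: real assume w: "\<bar>w\<bar> < 1"
      let ?z = "z(a := w)"
      have z': "\<bar>?z k\<bar> < 1" for k using w insert.prems(1) by simp
      \<comment> \<open>The induction hypothesis, with \<open>z a\<close> as the free variable \<open>w\<close>.\<close>
      have "(\<integral>\<omega>. ?W \<omega> * w ^ N a \<omega> \<partial>M) = (\<integral>\<omega>. (\<Prod>k\<in>A. of_bool (N k \<omega> = l k)) * (\<Prod>k\<in>F - A. ?z k ^ N k \<omega>) \<partial>M)"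
        unfolding split(1) prod.insert [OF finD split(2)]
        by (intro Bochner_Integration.integral_cong refl) (auto intro!: prod.cong)
      also have "\<dots> = (\<Prod>k\<in>A. q k (l k)) * (\<Prod>k\<in>F - A. \<kappa> k (?z k))"
        by (rule insert.IH [OF z' A(1)])
      also have "\<dots> = ?c * \<kappa> a w"
        unfolding split(1) prod.insert [OF finD split(2)] by (auto intro!: prod.cong)
      finally show "(\<lambda>l. ?c * q a l * w ^ l) sums (\<integral>\<omega>. ?W \<omega> * w ^ N a \<omega> \<partial>M)"
        using sums_mult [OF q [OF aF w], of ?c] by (simp add: mult.assoc)
    qed
    then show ?case
      using insert.hyps by (simp add: algebra_simps)
  qed
  have "prob {\<omega>\<in>space M. \<forall>k\<in>F. N k \<omega> = l k} = (\<integral>\<omega>. indicator {\<omega>\<in>space M. \<forall>k\<in>F. N k \<omega> = l k} \<omega> \<partial>M)"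
    by (simp add: Int_absorb2)
  also have "\<dots> = (\<integral>\<omega>. (\<Prod>k\<in>F. of_bool (N k \<omega> = l k)) \<partial>M)"
  proof (intro Bochner_Integration.integral_cong refl)
    fix \<omega> assume "\<omega> \<in> space M"
    show "indicator {\<omega>\<in>space M. \<forall>k\<in>F. N k \<omega> = l k} \<omega> = (\<Prod>k\<in>F. of_bool (N k \<omega> = l k) :: real)"
    proof (cases "\<forall>k\<in>F. N k \<omega> = l k")
      case True
      with \<open>\<omega> \<in> space M\<close> show ?thesis by simp
    next
      case False
      then have "(\<Prod>k\<in>F. of_bool (N k \<omega> = l k) :: real) = 0"
        by (intro prod_zero F) auto
      with False show ?thesis by simp
    qed
  qed
  also have "\<dots> = (\<Prod>k\<in>F. q k (l k))"
    using part [of "\<lambda>_. 0" F] by simp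
  finally show ?thesis .
qed

section \<open>Weak convergence from cylinder probabilities\<close>

text \<open>Lists of values on a window serve as a countable space through which all functions of finitely many
  coordinates factor.\<close>

definition window :: "nat \<Rightarrow> int list" where
  "window N = [- int N..int N]"

definition unwindow :: "nat \<Rightarrow> nat list \<Rightarrow> occupation" where
  "unwindow N xs k = (if k \<in> set (window N) then xs ! nat (k + int N) else 0)"

lemma set_window: "set (window N) = {- int N..int N}"
  by (simp add: window_def)

lemma nth_window: "k \<in> {- int N..int N} \<Longrightarrow> window N ! nat (k + int N) = k \<and> nat (k + int N) < length (window N)"
  by (auto simp: window_def nth_upto)

lemma map_window_eq_iff:
  "map \<eta> (window N) = xs \<longleftrightarrow> length xs = length (window N) \<and> (\<forall>k\<in>{- int N..int N}. \<eta> k = unwindow N xs k)"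
proof (intro iffI conjI)
  assume *: "map \<eta> (window N) = xs"
  then show "length xs = length (window N)" by auto
  show "\<forall>k\<in>{- int N..int N}. \<eta> k = unwindow N xs k"
  proof
    fix k assume k: "k \<in> {- int N..int N}"
    with nth_window [OF k] show "\<eta> k = unwindow N xs k"
      by (simp only: unwindow_def set_window if_True * [symmetric] nth_map)
  qed
next
  assume *: "length xs = length (window N) \<and> (\<forall>k\<in>{- int N..int N}. \<eta> k = unwindow N xs k)"
  show "map \<eta> (window N) = xs"
  proof (rule nth_equalityI)
    fix i assume "i < length (map \<eta> (window N))"
    then have i: "i < 2 * N + 1" by (simp add: window_def nat_add_distrib nat_mult_distrib) 
    have w: "window N ! i = int i - int N"
      unfolding window_def by (subst nth_upto) (use i in auto)
    with i have "window N ! i \<in> {- int N..int N}" by auto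
    with * have "\<eta> (window N ! i) = unwindow N xs (window N ! i)" by blast
    also have "\<dots> = xs ! i"
      using i unfolding unwindow_def set_window w by auto
    finally show "map \<eta> (window N) ! i = xs ! i"
      using i by (simp add: window_def)
  qed (use * in simp)
qed

lemma cylinder_in_sets: "finite F \<Longrightarrow> {\<eta>. \<forall>k\<in>F. \<eta> k = l k} \<in> sets occupation_space"
proof -
  assume "finite F"
  then have "{\<eta> \<in> space occupation_space. \<forall>k\<in>F. \<eta> k = l k} \<in> sets occupation_space"
    unfolding occupation_space_def by measurable
  then show ?thesis by (simp add: occupation_space_def space_PiM)
qed

lemma space_occupation_space: "space occupation_space = UNIV"
  by (simp add: occupation_space_def space_PiM)

lemma vimage_window:
  "(\<lambda>\<eta>. map \<eta> (window N)) -` {xs} =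
    (if length xs = length (window N) then {\<eta>. \<forall>k\<in>{- int N..int N}. \<eta> k = unwindow N xs k} else {})"
proof -
  have "(\<lambda>\<eta>. map \<eta> (window N)) -` {xs} = {\<eta>. map \<eta> (window N) = xs}" by auto
  then show ?thesis by (simp add: map_window_eq_iff)
qed

lemma measurable_window: "(\<lambda>\<eta>. map \<eta> (window N)) \<in> occupation_space \<rightarrow>\<^sub>M count_space UNIV"
  by (subst measurable_count_space_eq2_countable)
    (simp_all add: vimage_window space_occupation_space cylinder_in_sets)

lemma integral_countable_valued:
  fixes h :: "'b::countable \<Rightarrow> real"
  assumes "prob_space M" and T: "T \<in> M \<rightarrow>\<^sub>M count_space UNIV"
  shows "(\<integral>\<omega>. h (T \<omega>) \<partial>M) = (\<integral>b. measure M (T -` {b} \<inter> space M) * h b \<partial>count_space UNIV)"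
proof -
  interpret prob_space M by fact
  have "distr M (count_space UNIV) T = density (count_space UNIV) (\<lambda>b. ennreal (measure M (T -` {b} \<inter> space M)))"
  proof (rule measure_eqI_countable [where A = UNIV])
    show "emeasure (distr M (count_space UNIV) T) {b} =
        emeasure (density (count_space UNIV) (\<lambda>b. ennreal (measure M (T -` {b} \<inter> space M)))) {b}" for b
      using T by (simp add: emeasure_distr emeasure_density nn_integral_count_space_indicator [symmetric]
          one_ennreal_def [symmetric] emeasure_eq_measure nn_integral_count_space_finite)
  qed auto
  then have "(\<integral>b. h b \<partial>distr M (count_space UNIV) T) =
      (\<integral>b. h b \<partial>density (count_space UNIV) (\<lambda>b. ennreal (measure M (T -` {b} \<inter> space M))))"
    by (rule arg_cong)
  also have "(\<integral>b. h b \<partial>distr M (count_space UNIV) T) = (\<integral>\<omega>. h (T \<omega>) \<partial>M)"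
    using T by (subst integral_distr) auto
  also have "(\<integral>b. h b \<partial>density (count_space UNIV) (\<lambda>b. ennreal (measure M (T -` {b} \<inter> space M)))) =
      (\<integral>b. measure M (T -` {b} \<inter> space M) *\<^sub>R h b \<partial>count_space UNIV)"
    by (rule integral_density) auto
  finally show ?thesis by simp
qed

lemma integrable_point_masses:
  fixes T :: "'a \<Rightarrow> 'b::countable"
  assumes "prob_space M" and T: "T \<in> M \<rightarrow>\<^sub>M count_space UNIV"
  shows "integrable (count_space UNIV) (\<lambda>b. measure M (T -` {b} \<inter> space M))"
    and "(\<integral>b. measure M (T -` {b} \<inter> space M) \<partial>count_space UNIV) = 1"
proof -
  interpret prob_space M by fact
  show *: "(\<integral>b. measure M (T -` {b} \<inter> space M) \<partial>count_space UNIV) = 1"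
    using integral_countable_valued [OF assms, of "\<lambda>_. 1"] by (simp add: prob_space)
  then show "integrable (count_space UNIV) (\<lambda>b. measure M (T -` {b} \<inter> space M))"
    using not_integrable_integral_eq by fastforce
qed

text \<open>Scheffe's argument: for probability masses pointwise convergence implies convergence in the mean.\<close>

lemma tendsto_integral_countable_valued:
  fixes h :: "'b::countable \<Rightarrow> real"
  assumes M: "\<And>n. prob_space (M n)" "prob_space L"
    and T: "\<And>n. T \<in> M n \<rightarrow>\<^sub>M count_space UNIV" "T \<in> L \<rightarrow>\<^sub>M count_space UNIV"
    and lim: "\<And>b. (\<lambda>n. measure (M n) (T -` {b} \<inter> space (M n))) \<longlonglongrightarrow> measure L (T -` {b} \<inter> space L)"
    and h: "\<And>b. \<bar>h b\<bar> \<le> B"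
  shows "(\<lambda>n. \<integral>\<omega>. h (T \<omega>) \<partial>M n) \<longlonglongrightarrow> (\<integral>\<omega>. h (T \<omega>) \<partial>L)"
proof -
  let ?p = "\<lambda>n b. measure (M n) (T -` {b} \<inter> space (M n))" and ?q = "\<lambda>b. measure L (T -` {b} \<inter> space L)"
  let ?C = "count_space (UNIV :: 'b set)"
  note p = integrable_point_masses [OF M(1) T(1)] and q = integrable_point_masses [OF M(2) T(2)]
  have B0: "0 \<le> B" using h [of undefined] by linarith
  \<comment> \<open>Both families of masses have total \<open>1\<close>, so the total variation is twice the total deficit, and
    the deficit is dominated by the limit masses.\<close>
  have deficit: "(\<lambda>n. \<integral>b. max 0 (?q b - ?p n b) \<partial>?C) \<longlonglongrightarrow> (\<integral>b. 0 \<partial>?C)"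
  proof (rule integral_dominated_convergence [where w = ?q])
    show "AE b in ?C. (\<lambda>n. max 0 (?q b - ?p n b)) \<longlonglongrightarrow> 0"
    proof (intro AE_I2)
      fix b
      have "(\<lambda>n. max 0 (?q b - ?p n b)) \<longlonglongrightarrow> max 0 (?q b - ?q b)"
        by (intro tendsto_intros lim)
      then show "(\<lambda>n. max 0 (?q b - ?p n b)) \<longlonglongrightarrow> 0" by simp
    qed
  qed (use q in \<open>auto simp: max_def\<close>)
  have bound: "\<bar>(\<integral>\<omega>. h (T \<omega>) \<partial>M n) - (\<integral>\<omega>. h (T \<omega>) \<partial>L)\<bar> \<le> 2 * B * (\<integral>b. max 0 (?q b - ?p n b) \<partial>?C)" for n
  proof -
    have i1: "integrable ?C (\<lambda>b. ?p n b * h b)"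
      by (rule Bochner_Integration.integrable_bound [OF integrable_mult_left [OF p(1) [of n], of B]])
        (use h in \<open>auto simp: abs_mult intro!: mult_left_mono order_trans [OF h abs_ge_self]\<close>)
    have i2: "integrable ?C (\<lambda>b. ?q b * h b)"
      by (rule Bochner_Integration.integrable_bound [OF integrable_mult_left [OF q(1), of B]])
        (use h in \<open>auto simp: abs_mult intro!: mult_left_mono order_trans [OF h abs_ge_self]\<close>)
    have i3: "integrable ?C (\<lambda>b. max 0 (?q b - ?p n b))"
      using q(1) p(1) [of n] by (intro integrable_max) auto
    have "(\<integral>\<omega>. h (T \<omega>) \<partial>M n) - (\<integral>\<omega>. h (T \<omega>) \<partial>L) = (\<integral>b. ?p n b * h b - ?q b * h b \<partial>?C)"
      unfolding integral_countable_valued [OF M(1) T(1)] integral_countable_valued [OF M(2) T(2)]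
      using i1 i2 by simp
    also have "\<bar>\<dots>\<bar> \<le> (\<integral>b. \<bar>?p n b * h b - ?q b * h b\<bar> \<partial>?C)"
      using integral_norm_bound [of ?C "\<lambda>b. ?p n b * h b - ?q b * h b"] by simp
    also have "\<dots> \<le> (\<integral>b. B * (2 * max 0 (?q b - ?p n b) + (?p n b - ?q b)) \<partial>?C)"
    proof (rule integral_mono)
      show "integrable ?C (\<lambda>b. \<bar>?p n b * h b - ?q b * h b\<bar>)" using i1 i2 by auto
      show "integrable ?C (\<lambda>b. B * (2 * max 0 (?q b - ?p n b) + (?p n b - ?q b)))"
        using i3 p(1) [of n] q(1) by auto
      fix b
      have "\<bar>?p n b * h b - ?q b * h b\<bar> = \<bar>h b\<bar> * \<bar>?p n b - ?q b\<bar>"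
        by (simp add: algebra_simps flip: abs_mult)
      also have "\<dots> \<le> B * \<bar>?p n b - ?q b\<bar>" by (intro mult_right_mono h) auto
      also have "\<bar>?p n b - ?q b\<bar> = 2 * max 0 (?q b - ?p n b) + (?p n b - ?q b)"
        by (simp add: max_def)
      finally show "\<bar>?p n b * h b - ?q b * h b\<bar> \<le> B * (2 * max 0 (?q b - ?p n b) + (?p n b - ?q b))" .
    qed
    also have "\<dots> = 2 * B * (\<integral>b. max 0 (?q b - ?p n b) \<partial>?C)"
      using i3 p [of n] q by simp
    finally show ?thesis .
  qed
  have "(\<lambda>n. (\<integral>\<omega>. h (T \<omega>) \<partial>M n) - (\<integral>\<omega>. h (T \<omega>) \<partial>L)) \<longlonglongrightarrow> 0"
  proof (rule Lim_null_comparison)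
    show "\<forall>\<^sub>F n in sequentially. norm ((\<integral>\<omega>. h (T \<omega>) \<partial>M n) - (\<integral>\<omega>. h (T \<omega>) \<partial>L)) \<le> 2 * B * (\<integral>b. max 0 (?q b - ?p n b) \<partial>?C)"
      using bound by (intro always_eventually) simp
    show "(\<lambda>n. 2 * B * (\<integral>b. max 0 (?q b - ?p n b) \<partial>?C)) \<longlonglongrightarrow> 0"
      using tendsto_mult_left [OF deficit, of "2 * B"] by simp
  qed
  then show ?thesis by (rule LIM_zero_cancel)
qed

text \<open>The largest minorant of \<open>g\<close> that depends only on the coordinates in the window.\<close>

definition lower_envelope :: "(occupation \<Rightarrow> real) \<Rightarrow> nat \<Rightarrow> occupation \<Rightarrow> real" where
  "lower_envelope g N \<eta> = (INF \<zeta>\<in>{\<zeta>. \<forall>k\<in>{- int N..int N}. \<zeta> k = \<eta> k}. g \<zeta>)"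

lemma lower_envelope_bounds:
  assumes "\<And>\<zeta>. \<bar>g \<zeta>\<bar> \<le> B"
  shows "lower_envelope g N \<eta> \<le> g \<eta>" and "\<bar>lower_envelope g N \<eta>\<bar> \<le> B"
proof -
  have bd: "bdd_below (g ` A)" for A
    using assms by (intro bdd_belowI2 [of _ "- B"]) (simp add: abs_le_iff minus_le_iff)
  show *: "lower_envelope g N \<eta> \<le> g \<eta>"
    unfolding lower_envelope_def by (rule cINF_lower [OF bd]) simp
  have "- B \<le> lower_envelope g N \<eta>"
    unfolding lower_envelope_def using assms by (intro cINF_greatest) (auto simp: abs_le_iff minus_le_iff)
  with * assms [of \<eta>] show "\<bar>lower_envelope g N \<eta>\<bar> \<le> B" by linarith
qed

lemma lower_envelope_window:
  "lower_envelope g N \<eta> = lower_envelope g N (unwindow N (map \<eta> (window N)))"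
proof -
  have "\<forall>k\<in>{- int N..int N}. \<eta> k = unwindow N (map \<eta> (window N)) k"
    using map_window_eq_iff [of \<eta> N "map \<eta> (window N)"] by simp
  then have "{\<zeta>. \<forall>k\<in>{- int N..int N}. \<zeta> k = \<eta> k} =
      {\<zeta>. \<forall>k\<in>{- int N..int N}. \<zeta> k = unwindow N (map \<eta> (window N)) k}"
    by (intro Collect_cong ball_cong) simp_all
  then show ?thesis by (simp only: lower_envelope_def)
qed

text \<open>Each neighbourhood in the product topology constrains only finitely many of the discrete coordinates,
  so configurations that agree with \<open>\<eta>\<close> on a large window have almost the same value of \<open>g\<close>.\<close>

lemma lower_envelope_tendsto:
  assumes g: "continuous_map occupation_topology euclideanreal g" and B: "\<And>\<zeta>. \<bar>g \<zeta>\<bar> \<le> B"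
  shows "(\<lambda>N. lower_envelope g N \<eta>) \<longlonglongrightarrow> g \<eta>"
proof (rule LIMSEQ_I)
  fix e :: real assume e: "e > 0"
  let ?U = "{\<zeta>. g \<eta> - e / 2 < g \<zeta>}"
  have "continuous_on UNIV g" using g by (simp add: occupation_topology_eq)
  then have "open ?U" by (intro open_Collect_less continuous_intros)
  then have "openin (product_topology (\<lambda>_. euclidean) UNIV) ?U"
    by (simp add: open_fun_def)
  from product_topology_open_contains_basis [OF this, of \<eta>] e obtain X where
    X: "\<eta> \<in> Pi\<^sub>E UNIV X" "finite {k. X k \<noteq> UNIV}" "Pi\<^sub>E UNIV X \<subseteq> ?U"
    by auto
  \<comment> \<open>A window large enough to contain every coordinate that the basic neighbourhood constrains.\<close>
  define N0 where "N0 = Max (insert 0 ((\<lambda>k. nat \<bar>k\<bar>) ` {k. X k \<noteq> UNIV}))"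
  have N0: "nat \<bar>k\<bar> \<le> N0" if "X k \<noteq> UNIV" for k
    unfolding N0_def using X(2) that by (intro Max_ge) auto
  show "\<exists>no. \<forall>N\<ge>no. norm (lower_envelope g N \<eta> - g \<eta>) < e"
  proof (intro exI allI impI)
    fix N assume "N0 \<le> N"
    have "g \<eta> - e / 2 \<le> lower_envelope g N \<eta>"
      unfolding lower_envelope_def
    proof (rule cINF_greatest)
      fix \<zeta> assume \<zeta>: "\<zeta> \<in> {\<zeta>. \<forall>k\<in>{- int N..int N}. \<zeta> k = \<eta> k}"
      have "\<zeta> k \<in> X k" for k
      proof (cases "X k = UNIV")
        case False
        with N0 [OF this] \<open>N0 \<le> N\<close> have "k \<in> {- int N..int N}" by auto
        with \<zeta> have "\<zeta> k = \<eta> k" by blast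
        with X(1) show ?thesis by auto
      qed simp
      then have "\<zeta> \<in> ?U" using X(3) by auto
      then show "g \<eta> - e / 2 \<le> g \<zeta>" by simp
    qed auto
    with lower_envelope_bounds(1) [of g B N \<eta>, OF B] e show "norm (lower_envelope g N \<eta> - g \<eta>) < e"
      by simp
  qed
qed

text \<open>The integrals of the lower envelopes of \<open>g\<close> converge, since the envelopes depend on finitely many coordinates,
  and they approximate the integral of \<open>g\<close> against the limit from below. This bounds the lower limit of the integrals of \<open>g\<close>;
  the same bound for \<open>- g\<close> controls the upper limit.\<close>

lemma weakly_converges_cylinders:
  assumes M: "\<And>n. prob_space (\<mu> n)" "prob_space \<nu>"
    and sets: "\<And>n. sets (\<mu> n) = sets occupation_space" "sets \<nu> = sets occupation_space"
    and lim: "\<And>F l. finite F \<Longrightarrow> (\<lambda>n. measure (\<mu> n) {\<eta>. \<forall>k\<in>F. \<eta> k = l k}) \<longlonglongrightarrow> measure \<nu> {\<eta>. \<forall>k\<in>F. \<eta> k = l k}"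
  shows "weakly_converges \<mu> \<nu>"
proof -
  have space: "space (\<mu> n) = UNIV" "space \<nu> = UNIV" for n
    using sets [THEN sets_eq_imp_space_eq] by (simp_all add: space_occupation_space)
  have T: "(\<lambda>\<eta>. map \<eta> (window N)) \<in> \<mu> n \<rightarrow>\<^sub>M count_space UNIV" "(\<lambda>\<eta>. map \<eta> (window N)) \<in> \<nu> \<rightarrow>\<^sub>M count_space UNIV" for N n
    using measurable_window by (simp_all only: measurable_cong_sets [OF sets(1) refl] measurable_cong_sets [OF sets(2) refl])
  have env_lim: "(\<lambda>n. \<integral>\<eta>. lower_envelope g N \<eta> \<partial>\<mu> n) \<longlonglongrightarrow> (\<integral>\<eta>. lower_envelope g N \<eta> \<partial>\<nu>)"
    if B: "\<And>\<zeta>. \<bar>g \<zeta>\<bar> \<le> B" for g B N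
  proof -
    have "(\<lambda>n. \<integral>\<eta>. lower_envelope g N (unwindow N (map \<eta> (window N))) \<partial>\<mu> n) \<longlonglongrightarrow>
        (\<integral>\<eta>. lower_envelope g N (unwindow N (map \<eta> (window N))) \<partial>\<nu>)"
    proof (rule tendsto_integral_countable_valued [OF M T])
      show "(\<lambda>n. measure (\<mu> n) ((\<lambda>\<eta>. map \<eta> (window N)) -` {xs} \<inter> space (\<mu> n))) \<longlonglongrightarrow>
          measure \<nu> ((\<lambda>\<eta>. map \<eta> (window N)) -` {xs} \<inter> space \<nu>)" for xs
        by (simp add: vimage_window space lim)
    qed (rule lower_envelope_bounds(2) [OF B])
    then show ?thesis by (simp flip: lower_envelope_window)
  qed
  have meas: "lower_envelope g N \<in> borel_measurable occupation_space" for g N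
    using measurable_compose [OF measurable_window, of "\<lambda>xs. lower_envelope g N (unwindow N xs)" borel N]
    by (simp flip: lower_envelope_window)
  have lower: "\<forall>\<^sub>F n in sequentially. (\<integral>\<eta>. g \<eta> \<partial>\<nu>) - e < (\<integral>\<eta>. g \<eta> \<partial>\<mu> n)"
    if g: "continuous_map occupation_topology euclideanreal g" and B: "\<And>\<zeta>. \<bar>g \<zeta>\<bar> \<le> B" and e: "e > 0" for g B e
  proof -
    have "continuous_on UNIV g" using g by (simp add: occupation_topology_eq)
    then have "g \<in> borel_measurable occupation_space"
      unfolding measurable_cong_sets [OF sets_occupation_space refl] by (rule borel_measurable_continuous_onI)
    then have m: "g \<in> borel_measurable (\<mu> n)" "g \<in> borel_measurable \<nu>"
        "lower_envelope g N \<in> borel_measurable (\<mu> n)" "lower_envelope g N \<in> borel_measurable \<nu>" for n N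
      using meas by (simp_all only: measurable_cong_sets [OF sets(1) refl] measurable_cong_sets [OF sets(2) refl])
    interpret \<nu>: prob_space \<nu> by fact
    have "(\<lambda>N. \<integral>\<eta>. lower_envelope g N \<eta> \<partial>\<nu>) \<longlonglongrightarrow> (\<integral>\<eta>. g \<eta> \<partial>\<nu>)"
      by (rule integral_dominated_convergence [where w = "\<lambda>_. B"])
        (use m lower_envelope_tendsto [OF g B] lower_envelope_bounds(2) [OF B] in auto)
    then have "\<forall>\<^sub>F N in sequentially. (\<integral>\<eta>. g \<eta> \<partial>\<nu>) - e < (\<integral>\<eta>. lower_envelope g N \<eta> \<partial>\<nu>)"
      by (rule order_tendstoD) (use e in simp)
    then obtain N where "(\<integral>\<eta>. g \<eta> \<partial>\<nu>) - e < (\<integral>\<eta>. lower_envelope g N \<eta> \<partial>\<nu>)"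
      using eventually_happens' [OF sequentially_bot] by blast
    with env_lim [of g B N, OF B] have "\<forall>\<^sub>F n in sequentially. (\<integral>\<eta>. g \<eta> \<partial>\<nu>) - e < (\<integral>\<eta>. lower_envelope g N \<eta> \<partial>\<mu> n)"
      by (rule order_tendstoD)
    then show ?thesis
    proof eventually_elim
      case (elim n)
      interpret \<mu>: prob_space "\<mu> n" by (rule M)
      have "(\<integral>\<eta>. lower_envelope g N \<eta> \<partial>\<mu> n) \<le> (\<integral>\<eta>. g \<eta> \<partial>\<mu> n)"
        using m lower_envelope_bounds [of g B, OF B] B
        by (intro integral_mono \<mu>.integrable_const_bound [where B = B]) auto
      with elim show ?case by linarith
    qed
  qed
  show ?thesis
    unfolding weakly_converges_def
  proof (intro allI impI, elim conjE)
    fix g :: "occupation \<Rightarrow> real"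
    assume g: "continuous_map occupation_topology euclideanreal g" and "bounded (range g)"
    then obtain B where B: "\<And>\<zeta>. \<bar>g \<zeta>\<bar> \<le> B" by (auto simp: bounded_iff)
    have g': "continuous_map occupation_topology euclideanreal (\<lambda>\<eta>. - g \<eta>)"
      using g by (intro continuous_intros)
    show "(\<lambda>n. \<integral>\<eta>. g \<eta> \<partial>\<mu> n) \<longlonglongrightarrow> (\<integral>\<eta>. g \<eta> \<partial>\<nu>)"
    proof (rule tendstoI)
      fix e :: real assume e: "e > 0"
      have "\<forall>\<^sub>F n in sequentially. (\<integral>\<eta>. - g \<eta> \<partial>\<nu>) - e < (\<integral>\<eta>. - g \<eta> \<partial>\<mu> n)"
        by (rule lower [OF g' _ e, of B]) (simp add: B)
      with lower [OF g B e] show "\<forall>\<^sub>F n in sequentially. dist (\<integral>\<eta>. g \<eta> \<partial>\<mu> n) (\<integral>\<eta>. g \<eta> \<partial>\<nu>) < e"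
        by eventually_elim (simp add: dist_real_def abs_less_iff)
    qed
  qed
qed

section \<open>The hydrodynamic limit\<close>

lemma site_rate_nonneg: "(\<And>y. 0 \<le> \<gamma> y) \<Longrightarrow> 0 \<le> site_rate \<gamma> n m k"
  by (simp add: site_rate_def)

lemma measure_occupation_law_cylinder:
  assumes \<gamma>: "\<And>y. 0 \<le> \<gamma> y" "compact (closure {y. \<gamma> y \<noteq> 0})" and n: "n > 0" and F: "finite F"
  shows "measure (occupation_law \<gamma> n m) {\<eta>. \<forall>k\<in>F. \<eta> k = l k} =
    (\<Prod>k\<in>F. pmf (poisson (site_rate \<gamma> n m k)) (l k))"
proof -
  interpret prob_space "occupation_law \<gamma> n m"
    using \<gamma>(2) n by (rule prob_space_occupation_law)
  have space: "space (occupation_law \<gamma> n m) = UNIV"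
    by (simp add: occupation_law_def space_occupation_space)
  have "prob {\<eta>\<in>space (occupation_law \<gamma> n m). \<forall>k\<in>F. \<eta> k = l k} =
      (\<Prod>k\<in>F. pmf (poisson (site_rate \<gamma> n m k)) (l k))"
  proof (rule joint_pgf_determines_masses [OF F])
    show "(\<lambda>\<eta>. \<eta> k) \<in> occupation_law \<gamma> n m \<rightarrow>\<^sub>M count_space UNIV" for k
      by (simp add: occupation_law_def occupation_space_def)
    show "(\<lambda>l. pmf (poisson (site_rate \<gamma> n m k)) l * w ^ l) sums exp (site_rate \<gamma> n m k * (w - 1))" for k w
      using \<gamma>(1) by (intro poisson_pgf_sums site_rate_nonneg)
    show "(\<integral>\<eta>. (\<Prod>k\<in>F. z k ^ \<eta> k) \<partial>occupation_law \<gamma> n m) =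
        (\<Prod>k\<in>F. exp (site_rate \<gamma> n m k * (z k - 1)))" if "\<And>k. \<bar>z k\<bar> < 1" for z
      using that by (intro integral_occupation_pgf \<gamma> n F less_imp_le)
  qed
  then show ?thesis by (simp add: space)
qed

lemma measurable_translate:
  "(\<lambda>\<eta> j. \<eta> (j + c)) \<in> occupation_space \<rightarrow>\<^sub>M occupation_space" for c :: int
  unfolding occupation_space_def by (intro measurable_PiM_single' measurable_component_singleton) auto

lemma measure_translate_cylinder:
  assumes \<mu>: "sets \<mu> = sets occupation_space" and F: "finite F"
  shows "measure (translate c \<mu>) {\<eta>. \<forall>k\<in>F. \<eta> k = l k} = measure \<mu> {\<eta>. \<forall>k\<in>(\<lambda>k. k + c) ` F. \<eta> k = l (k - c)}"
proof -
  have "space \<mu> = UNIV"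
    using sets_eq_imp_space_eq [OF \<mu>] by (simp add: space_occupation_space)
  moreover have "(\<lambda>\<eta> j. \<eta> (j + c)) \<in> \<mu> \<rightarrow>\<^sub>M occupation_space"
    using measurable_translate by (simp only: measurable_cong_sets [OF \<mu> refl])
  ultimately show ?thesis
    unfolding translate_def by (subst measure_distr) (auto intro: cylinder_in_sets F arg_cong [where f = "measure \<mu>"])
qed

lemma measure_poisson_product_cylinder:
  assumes "finite F"
  shows "measure (poisson_product \<alpha>) {\<eta>. \<forall>k\<in>F. \<eta> k = l k} = (\<Prod>k\<in>F. pmf (poisson \<alpha>) (l k))"
proof -
  interpret product_prob_space "\<lambda>_ :: int. measure_pmf (poisson \<alpha>)" UNIV
    by standard
  have "{\<eta>. \<forall>k\<in>F. \<eta> k = l k} = prod_emb UNIV (\<lambda>_. measure_pmf (poisson \<alpha>)) F (\<Pi>\<^sub>E k\<in>F. {l k})"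
    by (auto simp: prod_emb_def space_PiM PiE_def Pi_def)
  then show ?thesis
    using measure_PiM_emb [of F "\<lambda>k. {l k}"] assms
    by (simp add: poisson_product_def measure_pmf_single)
qed

lemma limit_profile_nonneg:
  assumes "\<And>y. 0 \<le> \<gamma> y" "t > 0"
  shows "0 \<le> limit_profile \<gamma> t x"
  unfolding limit_profile_def using assms by (intro Bochner_Integration.integral_nonneg) (simp add: konno_density_nonneg)

text \<open>At \<open>n = 0\<close> all rates equal half of \<open>\<gamma> 0\<close>, because division by zero yields zero, so infinitely many
  states may be occupied; the limit is therefore taken along the positive indices.\<close>

lemma weakly_converges_Suc:
  "weakly_converges (\<lambda>n. \<mu> (Suc n)) \<nu> \<Longrightarrow> weakly_converges \<mu> \<nu>"
  unfolding weakly_converges_def by (blast intro: LIMSEQ_imp_Suc)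

theorem theorem3p1:
  fixes \<gamma> :: "real \<Rightarrow> real" and x t :: real
  assumes "continuous_on UNIV \<gamma>"
    and "\<And>y. 0 \<le> \<gamma> y"
    and "compact (closure {y. \<gamma> y \<noteq> 0})"
    and "t > 0"
  shows "weakly_converges
    (\<lambda>n. translate \<lfloor>x * real n\<rfloor> (occupation_law \<gamma> n (nat \<lfloor>t * real n\<rfloor>)))
    (poisson_product (limit_profile \<gamma> t x))"
proof (rule weakly_converges_Suc, rule weakly_converges_cylinders)
  let ?m = "\<lambda>n. nat \<lfloor>t * real n\<rfloor>" and ?c = "\<lambda>n. \<lfloor>x * real n\<rfloor>" and ?\<rho> = "limit_profile \<gamma> t x"
  have sets_occ: "sets (occupation_law \<gamma> n m) = sets occupation_space" for n m
    by (simp add: occupation_law_def)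
  show "prob_space (translate (?c (Suc n)) (occupation_law \<gamma> (Suc n) (?m (Suc n))))" for n
    unfolding translate_def
    by (intro prob_space.prob_space_distr prob_space_occupation_law assms)
      (simp_all only: measurable_cong_sets [OF sets_occ refl] measurable_translate zero_less_Suc)
  show "prob_space (poisson_product ?\<rho>)"
    unfolding poisson_product_def by (intro prob_space_PiM measure_pmf.prob_space_axioms)
  show "sets (translate (?c (Suc n)) (occupation_law \<gamma> (Suc n) (?m (Suc n)))) = sets occupation_space" for n
    by (simp add: translate_def)
  show "sets (poisson_product ?\<rho>) = sets occupation_space"
    unfolding poisson_product_def occupation_space_def by (rule sets_PiM_cong) simp_all
  fix F :: "int set" and l :: occupation
  assume F: "finite F"
  have "measure (translate (?c (Suc n)) (occupation_law \<gamma> (Suc n) (?m (Suc n)))) {\<eta>. \<forall>k\<in>F. \<eta> k = l k} =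
      (\<Prod>k\<in>F. pmf (poisson (site_rate \<gamma> (Suc n) (?m (Suc n)) (k + ?c (Suc n)))) (l k))" for n
    unfolding measure_translate_cylinder [OF sets_occ F]
    by (subst measure_occupation_law_cylinder) (use assms F in \<open>auto simp: prod.reindex inj_on_def\<close>)
  moreover have "(\<lambda>n. \<Prod>k\<in>F. pmf (poisson (site_rate \<gamma> (Suc n) (?m (Suc n)) (k + ?c (Suc n)))) (l k))
      \<longlonglongrightarrow> (\<Prod>k\<in>F. pmf (poisson ?\<rho>) (l k))"
    unfolding pmf_poisson_nonneg [OF site_rate_nonneg [OF assms(2)]]
      pmf_poisson_nonneg [OF limit_profile_nonneg [OF assms(2,4)]]
    by (intro tendsto_prod tendsto_divide tendsto_mult tendsto_exp tendsto_minus tendsto_power tendsto_const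
        LIMSEQ_Suc [OF site_rate_tendsto] assms) simp
  ultimately show "(\<lambda>n. measure (translate (?c (Suc n)) (occupation_law \<gamma> (Suc n) (?m (Suc n)))) {\<eta>. \<forall>k\<in>F. \<eta> k = l k})
      \<longlonglongrightarrow> measure (poisson_product ?\<rho>) {\<eta>. \<forall>k\<in>F. \<eta> k = l k}"
    by (simp only: measure_poisson_product_cylinder [OF F])
qed

end
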